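(* Let $E$ be a vector lattice with the countable sup property, and suppose that $E$ has an order dense ideal $F$ such that $F^\sim_{\mathrm{oc}}$ separates the points of $F$. Let $G$ be a regular vector sublattice of $E$. Then $G$ admits a (necessarily unique) Hausdorff uo-Lebesgue topology $\widehat\tau_G$, and the following are equivalent: (1) there exists a topology $\tau$ on $G$ such that, for every sequence $(x_n)_{n=1}^\infty$ in $G$ and for every $x\in G$, $x_n\xrightarrow{\mathrm{uo}}x$ in $G$ if and only if $x_n\to x$ in $\tau$; (2) for every sequence $(x_n)_{n=1}^\infty$ in $G$ and for every $x\in G$, the fact that $x_n\to x$ in $\widehat\tau_G$ implies that $x_n\xrightarrow{\mathrm{uo}}x$ in $G$. In that case, one can take $\widehat\tau_G$ for $\tau$.
   Context: All vector lattices are real and Archimedean. A vector lattice $E$ has the countable sup property if every non-empty subset of $E$ that has a supremum in $E$ has an at most countable subset with the same supremum. A vector sublattice $F$ of $E$ is order dense if for every $x\in E$ with $x>0$ there is $y\in F$ with $0<y\le x$; it is regular if for every net in $F$, $x_\alpha\downarrow 0$ in $F$ implies $x_\alpha\downarrow 0$ in $E$. A net $(x_\alpha)_{\alpha\in\mathcal A}$ in $E$ is order convergent to $x$ ($x_\alpha\xrightarrow{\mathrm o}x$) if there is a net $(y_\beta)_{\beta\in\mathcal B}$ in $E$ (possibly with a different index set) with $y_\beta\downarrow 0$ such that for every $\beta_0\in\mathcal B$ there is $\alpha_0\in\mathcal A$ with $|x-x_\alpha|\le y_{\beta_0}$ for all $\alpha\ge\alpha_0$; it is unbounded order convergent to $x$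 ($x_\alpha\xrightarrow{\mathrm{uo}}x$) if $|x_\alpha-x|\wedge y\xrightarrow{\mathrm o}0$ in $E$ for all $y\in E^+$. $F^\sim_{\mathrm{oc}}$ is the space of order continuous linear functionals on $F$ (those mapping nets order convergent to $0$ to nets convergent to $0$). A uo-Lebesgue topology is a locally solid linear topology (a vector space topology, not necessarily Hausdorff, with a base of solid neighbourhoods of $0$) such that uo-convergence of a net to $x$ implies its topological convergence to $x$. The topology $\tau$ in (1) is an arbitrary topology on the set $G$. *)

theory Defs
  imports "HOL-Analysis.Analysis" "HOL-Library.Lattice_Algebras" "HOL-Library.Lub_Glb"
begin

class archimedean_vector_lattice = ordered_real_vector + lattice_ab_group_add_abs +
  assumes archimedean: "0 \<le> x \<Longrightarrow> (\<And>n::nat. real n *\<^sub>R x \<le> y) \<Longrightarrow> x = 0"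

text \<open>
  The ambient vector lattice \<open>E\<close> is the whole type. A vector sublattice is a subset \<open>X\<close> of it;
  the notions below that depend on the lattice in which they are formed carry \<open>X\<close> as an
  argument, and suprema and infima in \<open>X\<close> are expressed with \<^const>\<open>isLub\<close> and \<^const>\<open>isGlb\<close>.
\<close>

definition countable_sup_property :: "'a::archimedean_vector_lattice set \<Rightarrow> bool" where
  "countable_sup_property X \<longleftrightarrow>
     (\<forall>S s. S \<subseteq> X \<and> S \<noteq> {} \<and> isLub X S s \<longrightarrow> (\<exists>C\<subseteq>S. countable C \<and> isLub X C s))"

definition vector_sublattice :: "'a::archimedean_vector_lattice set \<Rightarrow> bool" where
  "vector_sublattice X \<longleftrightarrow> subspace X \<and> (\<forall>x\<in>X. \<forall>y\<in>X. sup x y \<in> X \<and> inf x y \<in> X)"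

definition solid_in :: "'a::archimedean_vector_lattice set \<Rightarrow> 'a set \<Rightarrow> bool" where
  "solid_in X V \<longleftrightarrow> V \<subseteq> X \<and> (\<forall>x\<in>X. \<forall>v\<in>V. \<bar>x\<bar> \<le> \<bar>v\<bar> \<longrightarrow> x \<in> V)"

definition lattice_ideal :: "'a::archimedean_vector_lattice set \<Rightarrow> bool" where
  "lattice_ideal X \<longleftrightarrow> subspace X \<and> solid_in UNIV X"

definition order_dense :: "'a::archimedean_vector_lattice set \<Rightarrow> bool" where
  "order_dense X \<longleftrightarrow> (\<forall>x>0. \<exists>y\<in>X. 0 < y \<and> y \<le> x)"

text \<open>
  A net is a function on a set \<open>A\<close> that is directed by a preorder \<open>r\<close>, where \<open>(a, b) \<in> r\<close>
  means that \<open>b\<close> is beyond \<open>a\<close>; its values outside \<open>A\<close> are irrelevant.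
\<close>

definition directed_index :: "'i set \<Rightarrow> 'i rel \<Rightarrow> bool" where
  "directed_index A r \<longleftrightarrow> A \<noteq> {} \<and> preorder_on A r \<and>
     (\<forall>a\<in>A. \<forall>b\<in>A. \<exists>c\<in>A. (a, c) \<in> r \<and> (b, c) \<in> r)"

definition net_filter :: "'i set \<Rightarrow> 'i rel \<Rightarrow> 'i filter" where
  "net_filter A r = (INF a\<in>A. principal {b \<in> A. (a, b) \<in> r})"

abbreviation nat_order :: "nat rel" where
  "nat_order \<equiv> {(m, n). m \<le> n}"

definition decreasing_to_0 ::
    "'a::archimedean_vector_lattice set \<Rightarrow> 'i set \<Rightarrow> 'i rel \<Rightarrow> ('i \<Rightarrow> 'a) \<Rightarrow> bool" where
  "decreasing_to_0 X A r x \<longleftrightarrow> directed_index A r \<and> x ` A \<subseteq> X \<and>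
     (\<forall>a\<in>A. \<forall>b\<in>A. (a, b) \<in> r \<longrightarrow> x b \<le> x a) \<and> isGlb X (x ` A) 0"

text \<open>
  HOL cannot quantify over all index types inside a formula. Where a definition speaks of
  arbitrary nets in a vector lattice \<open>'a\<close>, the index sets range over all subsets of the
  following type. It is large enough for the quantification to cover nets over
  every index type; see \<open>decreasing_to_0_reindex\<close> and \<open>net_reindex\<close> and their consequences
  at the end.
\<close>

type_synonym 'a net_index = "'a set \<times> 'a"

definition order_conv ::
    "'a::archimedean_vector_lattice set \<Rightarrow> 'i set \<Rightarrow> 'i rel \<Rightarrow> ('i \<Rightarrow> 'a) \<Rightarrow> 'a \<Rightarrow> bool" where
  "order_conv X A r x l \<longleftrightarrow>
     (\<exists>(B::'a net_index set) s y. decreasing_to_0 X B s y \<and>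
        (\<forall>b0\<in>B. \<exists>a0\<in>A. \<forall>a\<in>A. (a0, a) \<in> r \<longrightarrow> \<bar>l - x a\<bar> \<le> y b0))"

definition uo_conv ::
    "'a::archimedean_vector_lattice set \<Rightarrow> 'i set \<Rightarrow> 'i rel \<Rightarrow> ('i \<Rightarrow> 'a) \<Rightarrow> 'a \<Rightarrow> bool" where
  "uo_conv X A r x l \<longleftrightarrow> (\<forall>y\<in>X. 0 \<le> y \<longrightarrow> order_conv X A r (\<lambda>a. inf \<bar>x a - l\<bar> y) 0)"

definition regular_sublattice :: "'a::archimedean_vector_lattice set \<Rightarrow> bool" where
  "regular_sublattice X \<longleftrightarrow> vector_sublattice X \<and>
     (\<forall>(A::'a net_index set) r x. decreasing_to_0 X A r x \<longrightarrow> decreasing_to_0 UNIV A r x)"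

text \<open>The order continuous dual of \<open>X\<close>; the values of its elements outside \<open>X\<close> are irrelevant.\<close>

definition oc_dual :: "'a::archimedean_vector_lattice set \<Rightarrow> ('a \<Rightarrow> real) set" where
  "oc_dual X = {\<phi>.
     (\<forall>x\<in>X. \<forall>y\<in>X. \<phi> (x + y) = \<phi> x + \<phi> y) \<and>
     (\<forall>c. \<forall>x\<in>X. \<phi> (c *\<^sub>R x) = c * \<phi> x) \<and>
     (\<forall>(A::'a net_index set) r x. directed_index A r \<and> x ` A \<subseteq> X \<and> order_conv X A r x 0 \<longrightarrow>
        ((\<lambda>a. \<phi> (x a)) \<longlongrightarrow> 0) (net_filter A r))}"

definition separates_points :: "('a \<Rightarrow> real) set \<Rightarrow> 'a set \<Rightarrow> bool" where
  "separates_points \<Phi> X \<longleftrightarrow> (\<forall>x\<in>X. \<forall>y\<in>X. x \<noteq> y \<longrightarrow> (\<exists>\<phi>\<in>\<Phi>. \<phi> x \<noteq> \<phi> y))"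

definition linear_topology :: "'a::archimedean_vector_lattice set \<Rightarrow> 'a topology \<Rightarrow> bool" where
  "linear_topology X \<tau> \<longleftrightarrow> topspace \<tau> = X \<and>
     continuous_map (prod_topology \<tau> \<tau>) \<tau> (\<lambda>(x, y). x + y) \<and>
     continuous_map (prod_topology euclideanreal \<tau>) \<tau> (\<lambda>(c, x). c *\<^sub>R x)"

definition locally_solid_topology :: "'a::archimedean_vector_lattice set \<Rightarrow> 'a topology \<Rightarrow> bool" where
  "locally_solid_topology X \<tau> \<longleftrightarrow> linear_topology X \<tau> \<and> neighbourhood_base_at 0 (solid_in X) \<tau>"

definition uo_Lebesgue_topology :: "'a::archimedean_vector_lattice set \<Rightarrow> 'a topology \<Rightarrow> bool" where
  "uo_Lebesgue_topology X \<tau> \<longleftrightarrow> locally_solid_topology X \<tau> \<and>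
     (\<forall>(A::'a net_index set) r x. \<forall>l\<in>X.
        directed_index A r \<and> x ` A \<subseteq> X \<and> uo_conv X A r x l \<longrightarrow> limitin \<tau> x l (net_filter A r))"

lemma eventually_net_filter:
  assumes "directed_index A r"
  shows "eventually P (net_filter A r) \<longleftrightarrow> (\<exists>a\<in>A. \<forall>b\<in>A. (a, b) \<in> r \<longrightarrow> P b)"
proof -
  have tr: "\<And>a b c. (a, b) \<in> r \<Longrightarrow> (b, c) \<in> r \<Longrightarrow> (a, c) \<in> r"
    using assms by (auto simp: directed_index_def preorder_on_def dest: transD)
  have "eventually P (net_filter A r)
      \<longleftrightarrow> (\<exists>a\<in>A. eventually P (principal {b \<in> A. (a, b) \<in> r}))"
    unfolding net_filter_def
  proof (rule eventually_INF_base)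
    show "A \<noteq> {}" using assms by (simp add: directed_index_def)
    fix a b assume "a \<in> A" "b \<in> A"
    then obtain c where "c \<in> A" "(a, c) \<in> r" "(b, c) \<in> r"
      using assms unfolding directed_index_def by blast
    then show "\<exists>x\<in>A. principal {b \<in> A. (x, b) \<in> r}
        \<le> inf (principal {b \<in> A. (a, b) \<in> r}) (principal {ba \<in> A. (b, ba) \<in> r})"
      by (intro bexI[of _ c]) (auto dest: tr)
  qed
  then show ?thesis by (auto simp: eventually_principal)
qed

lemma directed_index_nat: "directed_index UNIV nat_order"
proof -
  have "\<exists>c. a \<le> c \<and> b \<le> c" for a b :: nat
    by (intro exI[of _ "max a b"]) simp
  then show ?thesis
    by (auto simp: directed_index_def preorder_on_def refl_on_def trans_def)
qed

lemma net_filter_nat: "net_filter UNIV nat_order = sequentially"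
  by (rule filter_eqI)
    (simp add: eventually_net_filter[OF directed_index_nat] eventually_sequentially)

lemma decreasing_to_0_reindex:
  fixes x :: "'i \<Rightarrow> 'a::archimedean_vector_lattice"
  assumes "decreasing_to_0 X A r x"
  obtains B :: "'a net_index set" and s y
  where "y ` B = x ` A"
    and "\<And>Y. decreasing_to_0 Y B s y \<longleftrightarrow> x ` A \<subseteq> Y \<and> isGlb Y (x ` A) 0"
proof -
  define B :: "'a net_index set" where "B = Pair {} ` x ` A"
  define s where "s = {(p, q). p \<in> B \<and> q \<in> B \<and> snd q \<le> snd p}"
  have im: "snd ` B = x ` A" by (force simp: B_def image_iff)
  have dir: "directed_index B s"
    unfolding directed_index_def
  proof (intro conjI ballI)
    show "B \<noteq> {}" using assms by (auto simp: B_def decreasing_to_0_def directed_index_def)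
    show "preorder_on B s"
      by (auto simp: preorder_on_def refl_on_def trans_def s_def)
    fix p q assume "p \<in> B" "q \<in> B"
    then obtain a b where ab: "a \<in> A" "p = ({}, x a)" "b \<in> A" "q = ({}, x b)"
      by (auto simp: B_def)
    moreover obtain c where "c \<in> A" "(a, c) \<in> r" "(b, c) \<in> r"
      using assms ab unfolding decreasing_to_0_def directed_index_def by blast
    moreover have "x c \<le> x a" "x c \<le> x b"
      using assms calculation by (auto simp: decreasing_to_0_def)
    ultimately show "\<exists>c\<in>B. (p, c) \<in> s \<and> (q, c) \<in> s"
      by (intro bexI[of _ "({}, x c)"]) (auto simp: s_def B_def)
  qed
  have "decreasing_to_0 Y B s snd \<longleftrightarrow> x ` A \<subseteq> Y \<and> isGlb Y (x ` A) 0" for Y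
    unfolding decreasing_to_0_def im using dir by (auto simp: s_def)
  with im show thesis by (rule that)
qed

lemma net_reindex:
  fixes x :: "'i \<Rightarrow> 'a"
  assumes "directed_index A r"
  obtains B :: "'a net_index set" and s y
  where "directed_index B s" and "y ` B = x ` A"
    and "\<And>P. (\<exists>b0\<in>B. \<forall>b\<in>B. (b0, b) \<in> s \<longrightarrow> P (y b)) \<longleftrightarrow>
               (\<exists>a0\<in>A. \<forall>a\<in>A. (a0, a) \<in> r \<longrightarrow> P (x a))"
proof -
  define T where "T a = x ` {b \<in> A. (a, b) \<in> r}" for a
  define B :: "'a net_index set" where "B = (\<Union>a\<in>A. {T a} \<times> T a)"
  define s where "s = {(p, q). p \<in> B \<and> q \<in> B \<and> fst q \<subseteq> fst p}"
  have rf: "(a, a) \<in> r" if "a \<in> A" for a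
    using assms that by (auto simp: directed_index_def preorder_on_def refl_on_def)
  have tr: "\<And>a b c. (a, b) \<in> r \<Longrightarrow> (b, c) \<in> r \<Longrightarrow> (a, c) \<in> r"
    using assms by (auto simp: directed_index_def preorder_on_def dest: transD)
  have T_self: "x a \<in> T a" if "a \<in> A" for a using rf that by (auto simp: T_def)
  have T_mono: "T b \<subseteq> T a" if "(a, b) \<in> r" for a b using that tr by (auto simp: T_def)
  have "directed_index B s"
    unfolding directed_index_def
  proof (intro conjI ballI)
    obtain a where "a \<in> A" using assms by (auto simp: directed_index_def)
    then show "B \<noteq> {}" using T_self by (auto simp: B_def)
    show "preorder_on B s"
      by (auto simp: preorder_on_def refl_on_def trans_def s_def)
    fix p q assume pq: "p \<in> B" "q \<in> B"
    then obtain a b where ab: "a \<in> A" "fst p = T a" "b \<in> A" "fst q = T b"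
      by (auto simp: B_def)
    then obtain c where c: "c \<in> A" "(a, c) \<in> r" "(b, c) \<in> r"
      using assms unfolding directed_index_def by blast
    then have "(T c, x c) \<in> B" using T_self by (auto simp: B_def)
    then show "\<exists>c\<in>B. (p, c) \<in> s \<and> (q, c) \<in> s"
      using pq ab c T_mono by (intro bexI[of _ "(T c, x c)"]) (simp_all add: s_def)
  qed
  moreover have "snd ` B = x ` A"
  proof
    show "snd ` B \<subseteq> x ` A" by (auto simp: B_def T_def)
    show "x ` A \<subseteq> snd ` B"
    proof
      fix z assume "z \<in> x ` A"
      then obtain a where "a \<in> A" "z = x a" by blast
      then have "(T a, z) \<in> B" using T_self by (auto simp: B_def)
      then show "z \<in> snd ` B" by force
    qed
  qed
  moreover have "(\<exists>b0\<in>B. \<forall>b\<in>B. (b0, b) \<in> s \<longrightarrow> P (snd b)) \<longleftrightarrow>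
      (\<exists>a0\<in>A. \<forall>a\<in>A. (a0, a) \<in> r \<longrightarrow> P (x a))" (is "?l \<longleftrightarrow> ?r") for P
  proof
    assume ?l
    then obtain b0 where b0: "b0 \<in> B" "\<And>b. b \<in> B \<Longrightarrow> (b0, b) \<in> s \<Longrightarrow> P (snd b)" by blast
    then obtain a0 where a0: "a0 \<in> A" "fst b0 = T a0" by (auto simp: B_def)
    have "P (x a)" if "a \<in> A" "(a0, a) \<in> r" for a
    proof -
      have "(T a, x a) \<in> B" using that T_self by (auto simp: B_def)
      then show ?thesis using b0(2)[of "(T a, x a)"] b0(1) a0 that T_mono by (auto simp: s_def)
    qed
    with a0 show ?r by blast
  next
    assume ?r
    then obtain a0 where a0: "a0 \<in> A" "\<And>a. a \<in> A \<Longrightarrow> (a0, a) \<in> r \<Longrightarrow> P (x a)" by blast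
    then have "(T a0, x a0) \<in> B" using T_self by (auto simp: B_def)
    moreover have "P (snd b)" if "((T a0, x a0), b) \<in> s" for b
    proof -
      have "snd b \<in> fst b" "fst b \<subseteq> T a0" using that by (auto simp: s_def B_def)
      then show ?thesis using a0 by (auto simp: T_def)
    qed
    ultimately show ?l by blast
  qed
  ultimately show thesis by (rule that)
qed

lemma order_convI:
  fixes x :: "'i \<Rightarrow> 'a::archimedean_vector_lattice" and y :: "'j \<Rightarrow> 'a"
  assumes y: "decreasing_to_0 X B s y"
    and le: "\<And>b0. b0 \<in> B \<Longrightarrow> \<exists>a0\<in>A. \<forall>a\<in>A. (a0, a) \<in> r \<longrightarrow> \<bar>l - x a\<bar> \<le> y b0"
  shows "order_conv X A r x l"
proof -
  obtain B' :: "'a net_index set" and s' y' where im: "y' ` B' = y ` B"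
    and dec: "\<And>Y. decreasing_to_0 Y B' s' y' \<longleftrightarrow> y ` B \<subseteq> Y \<and> isGlb Y (y ` B) 0"
    by (rule decreasing_to_0_reindex[OF y], rule that)
  have "decreasing_to_0 X B' s' y'" using y unfolding dec by (simp add: decreasing_to_0_def)
  moreover have "\<exists>a0\<in>A. \<forall>a\<in>A. (a0, a) \<in> r \<longrightarrow> \<bar>l - x a\<bar> \<le> y' b" if "b \<in> B'" for b
  proof -
    have "y' b \<in> y ` B" using that im by blast
    then obtain b0 where "b0 \<in> B" "y' b = y b0" by blast
    with le show ?thesis by simp
  qed
  ultimately show ?thesis unfolding order_conv_def by blast
qed

lemma regular_sublatticeD:
  fixes x :: "'i \<Rightarrow> 'a::archimedean_vector_lattice"
  assumes "regular_sublattice X" and x: "decreasing_to_0 X A r x"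
  shows "decreasing_to_0 UNIV A r x"
proof -
  obtain B :: "'a net_index set" and s y where "y ` B = x ` A"
    and dec: "\<And>Y. decreasing_to_0 Y B s y \<longleftrightarrow> x ` A \<subseteq> Y \<and> isGlb Y (x ` A) 0"
    by (rule decreasing_to_0_reindex[OF x], rule that)
  have "decreasing_to_0 X B s y" using x unfolding dec by (simp add: decreasing_to_0_def)
  then have "decreasing_to_0 UNIV B s y"
    using assms(1) unfolding regular_sublattice_def by blast
  then show ?thesis using x unfolding dec by (simp add: decreasing_to_0_def)
qed

lemma oc_dualD:
  fixes x :: "'i \<Rightarrow> 'a::archimedean_vector_lattice"
  assumes "\<phi> \<in> oc_dual X" and dir: "directed_index A r" and "x ` A \<subseteq> X"
    and conv: "order_conv X A r x 0"
  shows "((\<lambda>a. \<phi> (x a)) \<longlongrightarrow> 0) (net_filter A r)"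
proof -
  obtain B :: "'a net_index set" and s y where dirB: "directed_index B s"
    and im: "y ` B = x ` A"
    and tails: "\<And>P. (\<exists>b0\<in>B. \<forall>b\<in>B. (b0, b) \<in> s \<longrightarrow> P (y b)) \<longleftrightarrow>
        (\<exists>a0\<in>A. \<forall>a\<in>A. (a0, a) \<in> r \<longrightarrow> P (x a))"
    by (rule net_reindex[OF dir, of x], rule that)
  have "order_conv X B s y 0"
    using conv by (simp only: order_conv_def tails[of "\<lambda>z. \<bar>0 - z\<bar> \<le> c" for c])
  moreover have "y ` B \<subseteq> X" using assms(3) im by simp
  ultimately have "((\<lambda>b. \<phi> (y b)) \<longlongrightarrow> 0) (net_filter B s)"
    using assms(1) dirB by (simp add: oc_dual_def)
  then show ?thesis
    by (simp only: tendsto_def eventually_net_filter[OF dir] eventually_net_filter[OF dirB]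
        tails[of "\<lambda>z. \<phi> z \<in> S" for S])
qed

lemma uo_Lebesgue_topologyD:
  fixes x :: "'i \<Rightarrow> 'a::archimedean_vector_lattice"
  assumes "uo_Lebesgue_topology X \<tau>" and dir: "directed_index A r" and "x ` A \<subseteq> X" "l \<in> X"
    and conv: "uo_conv X A r x l"
  shows "limitin \<tau> x l (net_filter A r)"
proof -
  obtain B :: "'a net_index set" and s y where dirB: "directed_index B s"
    and im: "y ` B = x ` A"
    and tails: "\<And>P. (\<exists>b0\<in>B. \<forall>b\<in>B. (b0, b) \<in> s \<longrightarrow> P (y b)) \<longleftrightarrow>
        (\<exists>a0\<in>A. \<forall>a\<in>A. (a0, a) \<in> r \<longrightarrow> P (x a))"
    by (rule net_reindex[OF dir, of x], rule that)
  have "uo_conv X B s y l"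
    using conv
    by (simp only: uo_conv_def order_conv_def tails[of "\<lambda>z. \<bar>0 - inf \<bar>z - l\<bar> u\<bar> \<le> c" for u c])
  moreover have "y ` B \<subseteq> X" using assms(3) im by simp
  ultimately have "limitin \<tau> y l (net_filter B s)"
    using assms(1,4) dirB by (simp add: uo_Lebesgue_topology_def)
  then show ?thesis
    unfolding limitin_def eventually_net_filter[OF dir] eventually_net_filter[OF dirB]
      tails[of "\<lambda>z. z \<in> S" for S] .
qed

end

(* The topology on G is generated by all Riesz pseudonorms along which uo-null nets of G become null.
   For an order continuous functional phi on F and u in F, u >= 0, the map x -> |phi|(|x| /\ u) is
   one of them, and these separate the points of G since F is order dense.

   Let U_k be solid neighbourhoods of 0 with U_(k+1) + U_(k+1) contained in U_k. In a uo-Lebesgue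
   topology a positive sequence b_k in U_k is uo-null as soon as every b_k is disjoint from the
   positive elements of the intersection of the U_k. The countable sup property makes it possible
   to choose the U_k such that their intersection meets countably many prescribed order intervals
   {0..y} only in 0. Together these give a uo-null subsequence of every topologically null
   sequence, hence the equivalence of (1) and (2). They also give uniqueness: a neighbourhood V of
   0 in another such topology contains all positive x disjoint from some fixed y, so one may pass
   from x_k in U_k but not in V to truncations |x_k| /\ n_k y, and these are uo-null. *)

theory Submission
  imports Defs
begin

section \<open>Vector lattices\<close>

text \<open>Two gaps shape the proof. \<open>G\<close> need not be Dedekind complete, so suprema and
  band projections are replaced by downward directed sets of differences with infimum 0; the
  uo-Lebesgue property puts a member of such a set into any given neighbourhood of 0. That the
  infimum is 0 always comes from the Archimedean property: what lies below all differences can be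
  subtracted again and again. Moreover, the topologies need not be metrizable, so the U_k may share
  nonzero elements. Disjointness repairs this: an element below all eventual upper bounds of the
  truncations of b_k lies in every U_k, is thus disjoint from the b_k, and can be subtracted from
  those bounds.

  The countable sup property concerns \<open>E\<close>, whereas the neighbourhoods live in
  \<open>G\<close>; regularity lets suprema found in \<open>G\<close> remain suprema in
  \<open>E\<close>. For (1) implies (2), a topologically convergent sequence that fails to converge
  in the topology of (1) has a subsequence avoiding an open set around the limit, but a
  uo-convergent selection from it must enter that set.\<close>

text \<open>Addition distributes over \<open>inf\<close>, so the right-hand side is the infimum of
  \<open>a + a\<close>, \<open>a + c\<close>, \<open>b + a\<close> and \<open>b + c\<close>. Each of
  these dominates the left-hand side.\<close>

lemma inf_add_le:
  fixes a b c :: "'a::lattice_ab_group_add"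
  assumes "0 \<le> a" "0 \<le> b" "0 \<le> c"
  shows "inf a (b + c) \<le> inf a b + inf a c"
proof -
  have "inf a (b + c) \<le> a + a" "inf a (b + c) \<le> a + c" "inf a (b + c) \<le> b + a"
    using assms by (auto intro: le_infI1 add_increasing add_increasing2)
  then show ?thesis
    by (simp add: add_sup_inf_distribs)
qed

lemma disjoint_add:
  fixes a b c :: "'a::lattice_ab_group_add"
  assumes "0 \<le> a" "0 \<le> b" "0 \<le> c" "inf a b = 0" "inf a c = 0"
  shows "inf a (b + c) = 0"
  using inf_add_le[OF assms(1-3)] assms by (simp add: antisym)

lemma disjoint_mono:
  fixes a b :: "'a::lattice_ab_group_add"
  assumes "0 \<le> a'" "0 \<le> b'" "a' \<le> a" "b' \<le> b" "inf a b = 0"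
  shows "inf a' b' = 0"
  using inf_mono[OF assms(3,4)] assms by (simp add: antisym)

lemma disjoint_sup:
  fixes a b c :: "'a::lattice_ab_group_add"
  assumes "0 \<le> a" "0 \<le> b" "0 \<le> c" "inf a b = 0" "inf a c = 0"
  shows "inf a (sup b c) = 0"
  using assms
  by (intro disjoint_mono[OF _ _ _ _ disjoint_add[OF assms]])
    (auto intro: le_supI1 add_increasing add_increasing2)

lemma disjoint_scale:
  fixes a b :: "'a::archimedean_vector_lattice"
  assumes "0 \<le> a" "0 \<le> b" "inf a b = 0"
  shows "inf a (real n *\<^sub>R b) = 0"
proof (induction n)
  case (Suc n)
  with disjoint_add[OF assms(1) _ assms(2) Suc assms(3)] assms show ?case
    by (simp add: scaleR_add_left add.commute scaleR_nonneg_nonneg)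
qed (use assms in \<open>simp add: inf_absorb2\<close>)

text \<open>For disjoint elements the sum is the supremum, by
  \<open>a + b = sup a b + inf a b\<close>.\<close>

lemma disjoint_add_le:
  fixes a b d :: "'a::lattice_ab_group_add"
  assumes "inf a b = 0" "a \<le> d" "b \<le> d"
  shows "a + b \<le> d"
  using assms by (simp add: add_eq_inf_sup[of a b])

lemma inf_add_le_add_inf:
  fixes a b u :: "'a::lattice_ab_group_add"
  assumes "0 \<le> a" "0 \<le> b" "0 \<le> u"
  shows "inf (a + b) u \<le> inf a u + inf b u"
  using inf_add_le[of u a b] assms by (simp add: inf_commute)

text \<open>Riesz decomposition: \<open>y\<close> is clipped to the interval from \<open>- a\<close>
  to \<open>a\<close>, and the part cut off has modulus at most \<open>b\<close>.\<close>

lemma abs_le_add_decompose: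
  fixes a b y :: "'a::archimedean_vector_lattice"
  assumes "0 \<le> a" "0 \<le> b" "\<bar>y\<bar> \<le> a + b"
  obtains y1 y2 where "y = y1 + y2" "\<bar>y1\<bar> \<le> a" "\<bar>y2\<bar> \<le> b"
proof
  define y1 where "y1 = inf (sup y (- a)) a"
  have ab: "y \<le> a + b" "- y \<le> a + b" using assms(3) by (auto simp: abs_le_iff)
  show "y = y1 + (y - y1)" by simp
  show "\<bar>y1\<bar> \<le> a"
  proof (rule abs_leI)
    have "- a \<le> a" using assms(1) by (metis minus_le_self_iff)
    then have "- a \<le> y1" by (simp add: y1_def)
    then show "- y1 \<le> a" by (simp add: minus_le_iff)
  qed (simp add: y1_def)
  show "\<bar>y - y1\<bar> \<le> b"
  proof (rule abs_leI)
    have "y - b \<le> y1" using assms(2) ab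
      by (auto simp: y1_def diff_le_eq intro: le_supI1 add_increasing2)
    then show "y - y1 \<le> b" by (simp add: diff_le_eq add.commute)
    have "- a - b \<le> y" using ab(2) minus_le_iff[of y "a + b"] by simp
    then have "- a \<le> y + b" by (simp only: diff_le_eq)
    then have "y1 \<le> y + b" using assms(2)
      by (auto simp: y1_def intro: le_infI1 add_increasing2)
    then show "- (y - y1) \<le> b" by (simp add: algebra_simps)
  qed
qed

section \<open>Two forms of the Archimedean argument\<close>

lemma scaleR_Suc: "real (Suc n) *\<^sub>R (e::'a::real_vector) = real n *\<^sub>R e + e"
  by (simp add: scaleR_add_left add.commute)

text \<open>All \<open>w - n e\<close> stay in \<open>D\<close> and hence above \<open>c\<close>, so
  the multiples of \<open>e\<close> are bounded by \<open>w - c\<close>. In the applications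
  \<open>D\<close> is a set of upper bounds or of differences, and \<open>e\<close> is a candidate
  lower bound to be shown zero.\<close>

lemma archimedean_descend:
  fixes e :: "'a::archimedean_vector_lattice"
  assumes "w \<in> D" and step: "\<And>d. d \<in> D \<Longrightarrow> d - e \<in> D" and low: "\<And>d. d \<in> D \<Longrightarrow> c \<le> d"
    and "0 \<le> e"
  shows "e = 0"
proof (rule archimedean[OF assms(4)])
  fix n :: nat
  have "w - real n *\<^sub>R e \<in> D"
  proof (induction n)
    case (Suc n)
    then show ?case using step[of "w - real n *\<^sub>R e"]
      by (simp only: scaleR_Suc diff_diff_add)
  qed (simp add: assms(1))
  from low[OF this] show "real n *\<^sub>R e \<le> w - c" by (simp add: algebra_simps)
qed

lemma archimedean_ascend:
  fixes e :: "'a::archimedean_vector_lattice"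
  assumes "0 \<le> w" "0 \<le> e"
    and step: "\<And>n::nat. real n *\<^sub>R e \<le> w \<Longrightarrow> real n *\<^sub>R e + e \<le> w"
  shows "e = 0"
proof (rule archimedean[OF assms(2)])
  fix n :: nat
  show "real n *\<^sub>R e \<le> w"
    by (induction n) (use assms(1) step in \<open>simp_all only: scaleR_Suc, simp\<close>)
qed

context
  fixes X :: "'a::archimedean_vector_lattice set"
  assumes X: "vector_sublattice X"
begin

lemma sublattice_zero: "0 \<in> X"
  and sublattice_add: "x \<in> X \<Longrightarrow> y \<in> X \<Longrightarrow> x + y \<in> X"
  and sublattice_diff: "x \<in> X \<Longrightarrow> y \<in> X \<Longrightarrow> x - y \<in> X"
  and sublattice_uminus: "x \<in> X \<Longrightarrow> - x \<in> X"
  and sublattice_scaleR: "x \<in> X \<Longrightarrow> c *\<^sub>R x \<in> X"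
  and sublattice_inf: "x \<in> X \<Longrightarrow> y \<in> X \<Longrightarrow> inf x y \<in> X"
  and sublattice_sup: "x \<in> X \<Longrightarrow> y \<in> X \<Longrightarrow> sup x y \<in> X"
  using X by (auto simp: vector_sublattice_def subspace_0 subspace_add subspace_diff
      subspace_neg subspace_scale)

lemma sublattice_abs: "x \<in> X \<Longrightarrow> \<bar>x\<bar> \<in> X"
  by (simp add: abs_lattice sublattice_sup sublattice_uminus)

lemmas sublattice_closed = sublattice_zero sublattice_add sublattice_diff sublattice_uminus
  sublattice_scaleR sublattice_inf sublattice_sup sublattice_abs

end

lemma vector_sublattice_ideal:
  assumes "lattice_ideal X"
  shows "vector_sublattice X"
proof -
  have sub: "subspace X" and sol: "\<And>x v. v \<in> X \<Longrightarrow> \<bar>x\<bar> \<le> \<bar>v\<bar> \<Longrightarrow> x \<in> X"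
    using assms by (auto simp: lattice_ideal_def solid_in_def)
  have ab: "\<bar>x\<bar> \<in> X" if "x \<in> X" for x using sol[of x "\<bar>x\<bar>"] that by simp
  have "sup x y \<in> X \<and> inf x y \<in> X" if "x \<in> X" "y \<in> X" for x y
  proof -
    have "\<bar>x\<bar> + \<bar>y\<bar> \<in> X" using ab that sub by (simp add: subspace_add)
    moreover have ub: "x \<le> \<bar>x\<bar> + \<bar>y\<bar>" "y \<le> \<bar>x\<bar> + \<bar>y\<bar>" "- x \<le> \<bar>x\<bar> + \<bar>y\<bar>" "- y \<le> \<bar>x\<bar> + \<bar>y\<bar>"
      by (auto intro: add_increasing add_increasing2 abs_ge_self abs_ge_minus_self)
    have "\<bar>sup x y\<bar> \<le> \<bar>x\<bar> + \<bar>y\<bar>" "\<bar>inf x y\<bar> \<le> \<bar>x\<bar> + \<bar>y\<bar>"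
      by (rule abs_leI, use ub in \<open>auto intro: le_infI1 le_infI2 le_supI1\<close>)+
    ultimately show ?thesis using sol[of "\<bar>x\<bar> + \<bar>y\<bar>"] by simp
  qed
  with sub show ?thesis by (simp add: vector_sublattice_def)
qed

section \<open>Order convergence in terms of sets\<close>

text \<open>A downward directed subset with infimum \<open>0\<close> carries the same information as a net
  decreasing to \<open>0\<close>, and it has no index type.\<close>

definition down_to_0 :: "'a::archimedean_vector_lattice set \<Rightarrow> 'a set \<Rightarrow> bool" where
  "down_to_0 X D \<longleftrightarrow> D \<subseteq> X \<and> D \<noteq> {} \<and> (\<forall>a\<in>D. \<forall>b\<in>D. \<exists>c\<in>D. c \<le> a \<and> c \<le> b) \<and>
     (\<forall>d\<in>D. 0 \<le> d) \<and> (\<forall>e\<in>X. 0 \<le> e \<longrightarrow> (\<forall>d\<in>D. e \<le> d) \<longrightarrow> e = 0)"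

abbreviation down_order :: "'a::order set \<Rightarrow> 'a rel" where
  "down_order D \<equiv> {(a, b). a \<in> D \<and> b \<in> D \<and> b \<le> a}"

lemma decreasing_to_0_of_set:
  assumes X: "vector_sublattice X" and D: "down_to_0 X D"
  shows "decreasing_to_0 X D (down_order D) (\<lambda>x. x)"
proof -
  \<comment> \<open>\<open>down_to_0\<close> only tests positive lower bounds; a general one is
    replaced by \<open>sup e 0\<close>, which is again a lower bound in \<open>X\<close>.\<close>
  have "e \<le> 0" if "e \<in> X" "\<forall>d\<in>D. e \<le> d" for e
  proof -
    have "sup e 0 = 0"
      using D that sublattice_sup[OF X that(1) sublattice_zero[OF X]]
      by (auto simp: down_to_0_def)
    then show ?thesis by (metis sup_ge1)
  qed
  then have "isGlb X D 0"
    using D sublattice_zero[OF X]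
    by (intro isGlbI2 isLbI) (auto simp: down_to_0_def setge_def setle_def isLb_def)
  moreover have "directed_index D (down_order D)"
    using D by (auto simp: directed_index_def down_to_0_def preorder_on_def refl_on_def trans_def)
  ultimately show ?thesis using D by (auto simp: decreasing_to_0_def down_to_0_def)
qed

lemma down_to_0_range:
  assumes "decreasing_to_0 X A r x"
  shows "down_to_0 X (x ` A)"
  unfolding down_to_0_def
proof (intro conjI ballI impI)
  have g: "isGlb X (x ` A) 0" using assms by (simp add: decreasing_to_0_def)
  show "x ` A \<subseteq> X" "x ` A \<noteq> {}"
    using assms by (auto simp: decreasing_to_0_def directed_index_def)
  show "0 \<le> d" if "d \<in> x ` A" for d using isGlbD2[OF g that] .
  show "e = 0" if "e \<in> X" "0 \<le> e" "\<forall>d\<in>x ` A. e \<le> d" for e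
    using isGlb_le_isLb[OF g isLbI, of e] that by (auto simp: setge_def)
  fix p q assume "p \<in> x ` A" "q \<in> x ` A"
  then obtain a b where ab: "a \<in> A" "b \<in> A" "p = x a" "q = x b" by blast
  moreover obtain c where "c \<in> A" "(a, c) \<in> r" "(b, c) \<in> r"
    using assms ab unfolding decreasing_to_0_def directed_index_def by blast
  moreover have "x c \<le> x a" "x c \<le> x b"
    using assms calculation by (auto simp: decreasing_to_0_def)
  ultimately show "\<exists>c\<in>x ` A. c \<le> p \<and> c \<le> q" by blast
qed

lemma order_conv_iff_set:
  assumes X: "vector_sublattice X"
  shows "order_conv X A r x l \<longleftrightarrow>
    (\<exists>D. down_to_0 X D \<and> (\<forall>d\<in>D. \<exists>a0\<in>A. \<forall>a\<in>A. (a0, a) \<in> r \<longrightarrow> \<bar>l - x a\<bar> \<le> d))" (is "_ \<longleftrightarrow> ?R")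
proof
  assume "order_conv X A r x l"
  then obtain B s and y :: "'a net_index \<Rightarrow> 'a" where y: "decreasing_to_0 X B s y"
    "\<forall>b0\<in>B. \<exists>a0\<in>A. \<forall>a\<in>A. (a0, a) \<in> r \<longrightarrow> \<bar>l - x a\<bar> \<le> y b0"
    unfolding order_conv_def by blast
  then show ?R by (intro exI[of _ "y ` B"]) (auto simp: down_to_0_range)
next
  assume ?R
  then obtain D where D: "down_to_0 X D"
    "\<forall>d\<in>D. \<exists>a0\<in>A. \<forall>a\<in>A. (a0, a) \<in> r \<longrightarrow> \<bar>l - x a\<bar> \<le> d" by blast
  then show "order_conv X A r x l"
    by (intro order_convI[OF decreasing_to_0_of_set[OF X D(1)]]) blast
qed

text \<open>The gateway from \<open>G\<close> to \<open>E\<close>: it is called whenever the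
  countable sup property of \<open>E\<close> or order continuity on \<open>F\<close> is applied to a
  set whose infimum was computed in \<open>G\<close>.\<close>

lemma regular_down_to_0:
  assumes G: "regular_sublattice G" and D: "down_to_0 G D"
  shows "down_to_0 UNIV D"
proof -
  have "vector_sublattice G" using G by (simp add: regular_sublattice_def)
  from down_to_0_range[OF regular_sublatticeD[OF G decreasing_to_0_of_set[OF this D]]]
  show ?thesis by simp
qed

lemma uo_conv_self_down_to_0:
  assumes X: "vector_sublattice X" and D: "down_to_0 X D"
  shows "uo_conv X D (down_order D) (\<lambda>x. x) 0"
  unfolding uo_conv_def
proof (intro ballI impI)
  fix y assume y: "y \<in> X" "0 \<le> y"
  have "\<bar>0 - (inf \<bar>a - 0\<bar> y)\<bar> \<le> d" if "d \<in> D" "a \<in> D" "a \<le> d" for a d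
    using D that y by (auto simp: down_to_0_def intro: le_infI1)
  then show "order_conv X D (down_order D) (\<lambda>a. inf \<bar>a - 0\<bar> y) 0"
    unfolding order_conv_iff_set[OF X] using D by blast
qed

text \<open>Stands in for the supremum of \<open>A\<close>, which may not exist in \<open>X\<close>:
  upper bounds and members of \<open>A\<close> come arbitrarily close. If \<open>h\<close> is below
  every difference, then subtracting \<open>h\<close> from an upper bound gives another upper bound,
  and the Archimedean property forces \<open>h = 0\<close>.\<close>

lemma down_to_0_gap:
  assumes X: "vector_sublattice X" and A: "A \<subseteq> X" "A \<noteq> {}"
    and dir: "\<And>a b. a \<in> A \<Longrightarrow> b \<in> A \<Longrightarrow> \<exists>c\<in>A. a \<le> c \<and> b \<le> c"
    and bd: "w \<in> X" "\<And>a. a \<in> A \<Longrightarrow> a \<le> w"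
  shows "down_to_0 X {d - a | d a. d \<in> X \<and> (\<forall>b\<in>A. b \<le> d) \<and> a \<in> A}" (is "down_to_0 X ?Z")
  unfolding down_to_0_def
proof (intro conjI ballI impI)
  show "?Z \<subseteq> X" using A sublattice_diff[OF X] by blast
  show "?Z \<noteq> {}" using A bd by blast
  show "\<And>z. z \<in> ?Z \<Longrightarrow> 0 \<le> z" by auto
  show "\<exists>c\<in>?Z. c \<le> p \<and> c \<le> q" if pq: "p \<in> ?Z" "q \<in> ?Z" for p q
  proof -
    from pq obtain d a d' a' where *: "p = d - a" "q = d' - a'" "d \<in> X" "d' \<in> X"
      "a \<in> A" "a' \<in> A" "\<forall>b\<in>A. b \<le> d" "\<forall>b\<in>A. b \<le> d'" by blast
    moreover obtain c where c: "c \<in> A" "a \<le> c" "a' \<le> c" using dir * by blast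
    ultimately show ?thesis
      by (intro bexI[of _ "inf d d' - c"] CollectI exI[of _ "inf d d'"] exI[of _ c])
        (auto intro!: diff_mono sublattice_inf[OF X])
  qed
  fix h assume h: "h \<in> X" "0 \<le> h" "\<forall>z\<in>?Z. h \<le> z"
  obtain a where a: "a \<in> A" using A by blast
  show "h = 0"
  proof (rule archimedean_descend[of w "{d \<in> X. \<forall>b\<in>A. b \<le> d}" h a])
    fix d assume d: "d \<in> {d \<in> X. \<forall>b\<in>A. b \<le> d}"
    have "b \<le> d - h" if "b \<in> A" for b
    proof -
      have "d - b \<in> ?Z" using d that by blast
      then have "h \<le> d - b" using h by blast
      then show ?thesis by (simp add: algebra_simps)
    qed
    with d h sublattice_diff[OF X] show "d - h \<in> {d \<in> X. \<forall>b\<in>A. b \<le> d}" by blast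
  qed (use a bd h in auto)
qed

text \<open>Stands in for the projection of \<open>x\<close> onto the band of \<open>y\<close>: the
  truncations by multiples of \<open>y\<close> approximate the component in the band, and the
  \<open>c\<close> approximate the component disjoint from it.\<close>

lemma down_to_0_disjoint_decomposition:
  assumes X: "vector_sublattice X" and x: "x \<in> X" "0 \<le> x" and y: "y \<in> X" "0 \<le> y"
  shows "down_to_0 X {x - (inf x (real n *\<^sub>R y) + c) | n c.
    c \<in> X \<and> 0 \<le> c \<and> c \<le> x \<and> inf y c = 0}" (is "down_to_0 X ?Z")
  unfolding down_to_0_def
proof (intro conjI ballI impI)
  note cl = sublattice_closed[OF X]
  show "?Z \<subseteq> X" using x y cl by auto
  show "?Z \<noteq> {}" using x y sublattice_zero[OF X] by (auto simp: inf_absorb2)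
  have below: "inf x (real n *\<^sub>R y) + c \<le> x"
    if "0 \<le> c" "c \<le> x" "inf y c = 0" for n :: nat and c
  proof (rule disjoint_add_le)
    have "inf c (real n *\<^sub>R y) = 0"
      using disjoint_scale[of c y n] that y by (simp add: inf_commute)
    then have "inf (real n *\<^sub>R y) c = 0" by (simp add: inf_commute)
    then show "inf (inf x (real n *\<^sub>R y)) c = 0"
      using that x y
      by (intro disjoint_mono[of "inf x (real n *\<^sub>R y)" c "real n *\<^sub>R y" c])
        (auto simp: scaleR_nonneg_nonneg)
  qed (use that in auto)
  then show "\<And>z. z \<in> ?Z \<Longrightarrow> 0 \<le> z" by auto
  show "\<exists>c\<in>?Z. c \<le> p \<and> c \<le> q" if pq: "p \<in> ?Z" "q \<in> ?Z" for p q
  proof -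
    from pq obtain n c n' c' where *:
      "p = x - (inf x (real n *\<^sub>R y) + c)" "c \<in> X" "0 \<le> c" "c \<le> x" "inf y c = 0"
      "q = x - (inf x (real n' *\<^sub>R y) + c')" "c' \<in> X" "0 \<le> c'" "c' \<le> x" "inf y c' = 0"
      by blast
    have m: "real n *\<^sub>R y \<le> real (max n n') *\<^sub>R y" "real n' *\<^sub>R y \<le> real (max n n') *\<^sub>R y"
      using y by (auto intro: scaleR_right_mono)
    let ?c = "x - (inf x (real (max n n') *\<^sub>R y) + sup c c')"
    have "?c \<le> p" "?c \<le> q" unfolding *
      by (intro diff_left_mono add_mono inf_mono m order_refl sup_ge1 sup_ge2)+
    moreover have "sup c c' \<in> X \<and> 0 \<le> sup c c' \<and> sup c c' \<le> x \<and> inf y (sup c c') = 0"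
      using * y cl(7) disjoint_sup[of y c c'] by (auto intro: le_supI1)
    then have "?c \<in> ?Z" by blast
    ultimately show ?thesis by blast
  qed
  fix h assume h: "h \<in> X" "0 \<le> h" and "\<forall>z\<in>?Z. h \<le> z"
  then have hz: "h \<le> x - (inf x (real n *\<^sub>R y) + c)"
    if "c \<in> X" "0 \<le> c" "c \<le> x" "inf y c = 0" for n c using that by blast
  have h1: "h + inf x (real n *\<^sub>R y) \<le> x" for n
    using hz[of 0 n] x y sublattice_zero[OF X]
    by (simp add: inf_absorb2 le_diff_eq del: diff_inf_eq_sup)
  have h2: "h + c \<le> x" if "c \<in> X" "0 \<le> c" "c \<le> x" "inf y c = 0" for c
    using hz[OF that, of 0] x y by (simp add: inf_absorb2 algebra_simps)
  \<comment> \<open>If the n-th multiple of \<open>inf h y\<close> is below \<open>x\<close>, it is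
    below \<open>inf x (real n *\<^sub>R y)\<close> as well, and \<open>h1\<close> leaves room for
    one more copy.\<close>
  have "inf h y = 0"
  proof (rule archimedean_ascend[of x])
    fix n :: nat assume n: "real n *\<^sub>R inf h y \<le> x"
    have "real n *\<^sub>R inf h y \<le> inf x (real n *\<^sub>R y)"
      using n by (auto intro: scaleR_left_mono)
    then have "real n *\<^sub>R inf h y + inf h y \<le> inf x (real n *\<^sub>R y) + h"
      by (intro add_mono) auto
    also have "\<dots> \<le> x" using h1[of n] by (simp add: add.commute)
    finally show "real n *\<^sub>R inf h y + inf h y \<le> x" .
  qed (use h x y in auto)
  then have yh: "inf y h = 0" by (simp add: inf_commute)
  \<comment> \<open>Now \<open>h\<close> is disjoint from \<open>y\<close>, so each multiple of
    \<open>h\<close> below \<open>x\<close> is itself an admissible \<open>c\<close>, and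
    \<open>h2\<close> leaves room for one more copy.\<close>
  show "h = 0"
  proof (rule archimedean_ascend[of x])
    fix n :: nat assume n: "real n *\<^sub>R h \<le> x"
    show "real n *\<^sub>R h + h \<le> x"
      using h2[of "real n *\<^sub>R h"] n h cl disjoint_scale[OF y(2) h(2) yh, of n]
      by (simp add: add.commute scaleR_nonneg_nonneg)
  qed (use h x in auto)
qed

section \<open>Neighbourhoods of zero\<close>

definition zero_nbhd :: "'a::zero topology \<Rightarrow> 'a set \<Rightarrow> bool" where
  "zero_nbhd \<tau> V \<longleftrightarrow> (\<exists>S. openin \<tau> S \<and> 0 \<in> S \<and> S \<subseteq> V)"

lemma zero_nbhd_mono: "zero_nbhd \<tau> U \<Longrightarrow> U \<subseteq> V \<Longrightarrow> zero_nbhd \<tau> V"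
  unfolding zero_nbhd_def by blast

lemma zero_nbhd_zero: "zero_nbhd \<tau> V \<Longrightarrow> 0 \<in> V"
  unfolding zero_nbhd_def by blast

lemma zero_nbhd_Int: "zero_nbhd \<tau> U \<Longrightarrow> zero_nbhd \<tau> V \<Longrightarrow> zero_nbhd \<tau> (U \<inter> V)"
  unfolding zero_nbhd_def by (metis IntI Int_mono openin_Int)

lemma openin_translation:
  assumes "linear_topology X \<tau>" "a \<in> X" "openin \<tau> S"
  shows "openin \<tau> {x \<in> X. a + x \<in> S}"
proof -
  have top: "topspace \<tau> = X" and add: "continuous_map (prod_topology \<tau> \<tau>) \<tau> (\<lambda>(x, y). x + y)"
    using assms(1) by (auto simp: linear_topology_def)
  have "continuous_map \<tau> (prod_topology \<tau> \<tau>) (\<lambda>x. (a, x))"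
    using assms(2) top by (intro continuous_map_pairedI) auto
  from openin_continuous_map_preimage[OF continuous_map_compose[OF this add] assms(3)]
  show ?thesis by (simp add: top o_def)
qed

text \<open>Translations by elements of \<open>X\<close> are continuous, so the neighbourhoods of 0
  determine the topology. Uniqueness is thereby reduced to a comparison of
  \<open>zero_nbhd\<close>.\<close>

lemma openin_iff_zero_nbhd:
  assumes X: "vector_sublattice X" and lin: "linear_topology X \<tau>"
  shows "openin \<tau> S \<longleftrightarrow> S \<subseteq> X \<and> (\<forall>a\<in>S. zero_nbhd \<tau> {x \<in> X. a + x \<in> S})"
proof
  have top: "topspace \<tau> = X" using lin by (simp add: linear_topology_def)
  show "S \<subseteq> X \<and> (\<forall>a\<in>S. zero_nbhd \<tau> {x \<in> X. a + x \<in> S})" if S: "openin \<tau> S"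
  proof (intro conjI ballI)
    show sub: "S \<subseteq> X" using openin_subset[OF S] top by simp
    fix a assume "a \<in> S"
    then show "zero_nbhd \<tau> {x \<in> X. a + x \<in> S}"
      unfolding zero_nbhd_def
      using openin_translation[OF lin _ S, of a] sub sublattice_zero[OF X]
      by (intro exI[of _ "{x \<in> X. a + x \<in> S}"]) auto
  qed
  assume R: "S \<subseteq> X \<and> (\<forall>a\<in>S. zero_nbhd \<tau> {x \<in> X. a + x \<in> S})"
  show "openin \<tau> S"
  proof (subst openin_subopen, intro ballI)
    fix a assume a: "a \<in> S"
    then obtain T where T: "openin \<tau> T" "0 \<in> T" "T \<subseteq> {x \<in> X. a + x \<in> S}"
      using R unfolding zero_nbhd_def by blast
    have "a \<in> X" using a R by blast
    then have "openin \<tau> {x \<in> X. - a + x \<in> T}"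
      using openin_translation[OF lin _ T(1), of "- a"] sublattice_uminus[OF X] by blast
    moreover have "{x \<in> X. - a + x \<in> T} \<subseteq> S" using T(3) by force
    ultimately show "\<exists>T. openin \<tau> T \<and> a \<in> T \<and> T \<subseteq> S"
      using T(2) \<open>a \<in> X\<close> by (intro exI[of _ "{x \<in> X. - a + x \<in> T}"]) simp
  qed
qed

lemma linear_topology_eqI:
  assumes "vector_sublattice X" "linear_topology X \<sigma>" "linear_topology X \<tau>"
    and "\<And>V. zero_nbhd \<sigma> V \<longleftrightarrow> zero_nbhd \<tau> V"
  shows "\<sigma> = \<tau>"
  using assms by (simp add: topology_eq openin_iff_zero_nbhd)

lemma limitin_zero_nbhd:
  assumes X: "vector_sublattice X" and lin: "linear_topology X \<tau>"
    and lim: "limitin \<tau> x l F" and V: "zero_nbhd \<tau> V"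
  shows "eventually (\<lambda>a. x a - l \<in> V) F"
proof -
  have top: "topspace \<tau> = X" using lin by (simp add: linear_topology_def)
  obtain T where T: "openin \<tau> T" "0 \<in> T" "T \<subseteq> V" using V unfolding zero_nbhd_def by blast
  have l: "l \<in> X" using lim top by (simp add: limitin_def)
  have "openin \<tau> {x \<in> X. - l + x \<in> T}"
    using openin_translation[OF lin _ T(1)] sublattice_uminus[OF X l] by blast
  moreover have "l \<in> {x \<in> X. - l + x \<in> T}" using T l by simp
  ultimately have "eventually (\<lambda>a. x a \<in> {x \<in> X. - l + x \<in> T}) F"
    using lim unfolding limitin_def by blast
  then show ?thesis by (rule eventually_mono) (use T(3) in auto)
qed

lemma Hausdorff_zero_nbhd:
  assumes "Hausdorff_space \<tau>" "x \<in> topspace \<tau>" "0 \<in> topspace \<tau>" "x \<noteq> 0"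
  obtains V where "zero_nbhd \<tau> V" "x \<notin> V"
  using assms unfolding Hausdorff_space_def zero_nbhd_def disjnt_def
  by (metis IntI empty_iff subset_refl)

lemma zero_nbhd_solid_half:
  assumes X: "vector_sublattice X" and ls: "locally_solid_topology X \<tau>" and V: "zero_nbhd \<tau> V"
  obtains U where "solid_in X U" "zero_nbhd \<tau> U" "\<And>x y. x \<in> U \<Longrightarrow> y \<in> U \<Longrightarrow> x + y \<in> V"
proof -
  have top: "topspace \<tau> = X" and add: "continuous_map (prod_topology \<tau> \<tau>) \<tau> (\<lambda>(x, y). x + y)"
    using ls by (auto simp: linear_topology_def locally_solid_topology_def)
  obtain T where T: "openin \<tau> T" "0 \<in> T" "T \<subseteq> V" using V unfolding zero_nbhd_def by blast
  let ?P = "{p \<in> topspace (prod_topology \<tau> \<tau>). (\<lambda>(x, y). x + y) p \<in> T}"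
  have op: "openin (prod_topology \<tau> \<tau>) ?P"
    by (rule openin_continuous_map_preimage[OF add T(1)])
  have mem: "(0, 0) \<in> ?P"
    using T sublattice_zero[OF X] by (simp add: top)
  obtain A B where AB: "openin \<tau> A" "openin \<tau> B" "0 \<in> A" "0 \<in> B" "A \<times> B \<subseteq> ?P"
    using openin_prod_topology_alt[THEN iffD1, rule_format, OF op mem] by blast
  obtain S U where U: "openin \<tau> S" "solid_in X U" "0 \<in> S" "S \<subseteq> U" "U \<subseteq> A \<inter> B"
    using ls openin_Int[OF AB(1,2)] IntI[OF AB(3,4)]
    unfolding locally_solid_topology_def neighbourhood_base_at_def by blast
  show thesis
  proof (rule that[OF U(2)])
    show "zero_nbhd \<tau> U" unfolding zero_nbhd_def using U by blast
    fix x y assume "x \<in> U" "y \<in> U"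
    then have "(x, y) \<in> A \<times> B" using U by blast
    then show "x + y \<in> V" using AB(5) T(3) by auto
  qed
qed

text \<open>A chain is a countable base at 0 of a possibly coarser, pseudometrizable locally solid
  topology.\<close>

definition nbhd_chain :: "'a::archimedean_vector_lattice set \<Rightarrow> 'a topology \<Rightarrow> (nat \<Rightarrow> 'a set) \<Rightarrow> bool"
  where "nbhd_chain X \<tau> U \<longleftrightarrow> (\<forall>k. solid_in X (U k) \<and> zero_nbhd \<tau> (U k) \<and>
     (\<forall>x\<in>U (Suc k). \<forall>y\<in>U (Suc k). x + y \<in> U k))"

text \<open>For a chain \<open>U\<close> this is the positive cone of an ideal of \<open>X\<close>,
  the closure of 0 in the topology of the chain. It measures how far the chain is from being
  Hausdorff.\<close>

definition chain_null :: "'a::archimedean_vector_lattice set \<Rightarrow> (nat \<Rightarrow> 'a set) \<Rightarrow> 'a set" where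
  "chain_null X U = {e \<in> X. 0 \<le> e \<and> (\<forall>k. e \<in> U k)}"

lemma nbhd_chainD:
  assumes "nbhd_chain X \<tau> U"
  shows "solid_in X (U k)" "zero_nbhd \<tau> (U k)" "0 \<in> U k" "U k \<subseteq> X"
    and "x \<in> U (Suc k) \<Longrightarrow> y \<in> U (Suc k) \<Longrightarrow> x + y \<in> U k"
    and "x \<in> X \<Longrightarrow> v \<in> U k \<Longrightarrow> \<bar>x\<bar> \<le> \<bar>v\<bar> \<Longrightarrow> x \<in> U k"
proof -
  have k: "solid_in X (U k)" "zero_nbhd \<tau> (U k)" "\<forall>x\<in>U (Suc k). \<forall>y\<in>U (Suc k). x + y \<in> U k"
    using assms by (auto simp: nbhd_chain_def)
  then show "solid_in X (U k)" "zero_nbhd \<tau> (U k)" "0 \<in> U k" "U k \<subseteq> X"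
    by (auto simp: solid_in_def zero_nbhd_zero)
  show "x \<in> U (Suc k) \<Longrightarrow> y \<in> U (Suc k) \<Longrightarrow> x + y \<in> U k" using k(3) by blast
  show "x \<in> X \<Longrightarrow> v \<in> U k \<Longrightarrow> \<bar>x\<bar> \<le> \<bar>v\<bar> \<Longrightarrow> x \<in> U k" using k(1) unfolding solid_in_def by blast
qed

lemma nbhd_chain_Suc_subset:
  assumes "nbhd_chain X \<tau> U"
  shows "U (Suc k) \<subseteq> U k"
  using nbhd_chainD(5)[OF assms, where y = 0] nbhd_chainD(3)[OF assms] by auto

lemma nbhd_chain_exists:
  fixes A :: "nat \<Rightarrow> 'a::archimedean_vector_lattice set"
  assumes X: "vector_sublattice X" and ls: "locally_solid_topology X \<tau>"
    and A: "\<And>n. zero_nbhd \<tau> (A n)"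
  obtains U where "nbhd_chain X \<tau> U" "\<And>n. U n \<subseteq> A n"
proof -
  define R where "R V U \<longleftrightarrow> solid_in X U \<and> zero_nbhd \<tau> U \<and> (\<forall>x\<in>U. \<forall>y\<in>U. x + y \<in> V)" for U V
  define h where "h V = (SOME U. R V U)" for V
  have h: "R V (h V)" if "zero_nbhd \<tau> V" for V
    unfolding h_def by (rule someI_ex) (metis zero_nbhd_solid_half[OF X ls that] R_def)
  have hs: "h V \<subseteq> V" if "zero_nbhd \<tau> V" for V
  proof
    fix x assume "x \<in> h V"
    moreover have "0 \<in> h V" using h[OF that] zero_nbhd_zero by (auto simp: R_def)
    ultimately have "x + 0 \<in> V" using h[OF that] unfolding R_def by blast
    then show "x \<in> V" by simp
  qed
  \<comment> \<open>Halving the intersection serves both demands at once: sums land in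
    \<open>U n\<close>, and \<open>U (Suc n)\<close> lies in \<open>A (Suc n)\<close>.\<close>
  define U where "U = rec_nat (h (A 0)) (\<lambda>n V. h (V \<inter> A (Suc n)))"
  have U0: "U 0 = h (A 0)" and US: "U (Suc n) = h (U n \<inter> A (Suc n))" for n
    by (simp_all add: U_def)
  have nb: "zero_nbhd \<tau> (U n)" for n
    by (induction n) (use h A in \<open>auto simp: U0 US R_def zero_nbhd_Int\<close>)
  have nb': "zero_nbhd \<tau> (U n \<inter> A (Suc n))" for n using nb A zero_nbhd_Int by blast
  have "solid_in X (U n)" for n
    using h[OF A] h[OF nb'] by (cases n) (auto simp: U0 US R_def)
  moreover have "x + y \<in> U n" if "x \<in> U (Suc n)" "y \<in> U (Suc n)" for x y n
    using h[OF nb'[of n]] that by (auto simp: US R_def)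
  moreover have "U n \<subseteq> A n" for n
    using hs[OF A] hs[OF nb'] by (cases n) (auto simp: U0 US)
  ultimately show thesis using nb by (intro that[of U]) (simp_all add: nbhd_chain_def)
qed

text \<open>As for a geometric series: the first term is in \<open>U (Suc m)\<close>, and so is the
  rest, by the induction hypothesis at \<open>Suc m\<close>. The bound is independent of
  \<open>N\<close>.\<close>

lemma nbhd_chain_sum:
  fixes b :: "nat \<Rightarrow> 'a::archimedean_vector_lattice"
  assumes U: "nbhd_chain X \<tau> U" and b: "\<And>k. b k \<in> U k"
  shows "(\<Sum>k<N. b (Suc (m + k))) \<in> U m"
proof (induction N arbitrary: m)
  case 0
  then show ?case using nbhd_chainD(3)[OF U] by simp
next
  case (Suc N)
  have "(\<Sum>k<Suc N. b (Suc (m + k))) = b (Suc m) + (\<Sum>k<N. b (Suc (Suc m + k)))"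
    by (simp add: sum.lessThan_Suc_shift del: sum.lessThan_Suc)
  then show ?case using nbhd_chainD(5)[OF U b Suc[of "Suc m"]] by simp
qed

lemma chain_null_add:
  assumes X: "vector_sublattice X" and U: "nbhd_chain X \<tau> U"
    and "x \<in> chain_null X U" "y \<in> chain_null X U"
  shows "x + y \<in> chain_null X U"
  using assms nbhd_chainD(5)[OF U] sublattice_add[OF X] by (auto simp: chain_null_def)

lemma chain_null_mono:
  assumes U: "nbhd_chain X \<tau> U"
    and "y \<in> chain_null X U" "x \<in> X" "0 \<le> x" "x \<le> y"
  shows "x \<in> chain_null X U"
proof -
  have "x \<in> U k" for k
    using nbhd_chainD(6)[OF U, of x y k] assms(2-5) by (simp add: chain_null_def)
  then show ?thesis using assms(3,4) by (simp add: chain_null_def)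
qed

section \<open>Consequences of the uo-Lebesgue property\<close>

context
  fixes X :: "'a::archimedean_vector_lattice set" and \<tau>
  assumes X: "vector_sublattice X" and uoL: "uo_Lebesgue_topology X \<tau>"
begin

private lemma ls: "locally_solid_topology X \<tau>"
  using uoL by (simp add: uo_Lebesgue_topology_def)

private lemma lin: "linear_topology X \<tau>"
  using ls by (simp add: locally_solid_topology_def)

lemma uo_Lebesgue_zero_nbhd:
  fixes A :: "'i set"
  assumes dir: "directed_index A r" and x: "x ` A \<subseteq> X" "l \<in> X" "uo_conv X A r x l"
    and V: "zero_nbhd \<tau> V"
  obtains a where "a \<in> A" "x a - l \<in> V"
proof -
  have "eventually (\<lambda>a. x a - l \<in> V) (net_filter A r)"
    by (rule limitin_zero_nbhd[OF X lin uo_Lebesgue_topologyD[OF uoL dir x] V])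
  then obtain a where a: "a \<in> A" "\<forall>b\<in>A. (a, b) \<in> r \<longrightarrow> x b - l \<in> V"
    unfolding eventually_net_filter[OF dir] by blast
  have "(a, a) \<in> r" using a(1) dir by (auto simp: directed_index_def preorder_on_def refl_on_def)
  with a that show thesis by blast
qed

text \<open>\<open>D\<close> ordered downwards is a uo-null net, hence topologically null. This is
  how infima computed in the lattice yield approximations in the topology.\<close>

lemma down_to_0_zero_nbhd:
  assumes D: "down_to_0 X D" and V: "zero_nbhd \<tau> V"
  obtains d where "d \<in> D" "d \<in> V"
proof -
  have "directed_index D (down_order D)" "(\<lambda>x. x) ` D \<subseteq> X"
    using decreasing_to_0_of_set[OF X D] by (auto simp: decreasing_to_0_def)
  from uo_Lebesgue_zero_nbhd[OF this sublattice_zero[OF X] uo_conv_self_down_to_0[OF X D] V]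
  show thesis using that by auto
qed

text \<open>The net of all \<open>x\<close>, indexed by the pairs \<open>(y, x)\<close> with \<open>x\<close> disjoint from \<open>y\<close> and ordered
  by the first component, is uo-null.\<close>

lemma disjoint_in_zero_nbhd:
  assumes V: "zero_nbhd \<tau> V"
  obtains y where "y \<in> X" "0 \<le> y" "\<And>x. x \<in> X \<Longrightarrow> 0 \<le> x \<Longrightarrow> inf y x = 0 \<Longrightarrow> x \<in> V"
proof -
  note cl = sublattice_closed[OF X]
  define A where "A = {(y, x). y \<in> X \<and> 0 \<le> y \<and> x \<in> X \<and> 0 \<le> x \<and> inf y x = 0}"
  define r where "r = {(p, q). p \<in> A \<and> q \<in> A \<and> fst p \<le> (fst q :: 'a)}"
  have dir: "directed_index A r"
    unfolding directed_index_def
  proof (intro conjI ballI)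
    have "(0, 0) \<in> A" using cl(1) by (simp add: A_def)
    then show "A \<noteq> {}" by blast
    show "preorder_on A r" by (auto simp: preorder_on_def refl_on_def trans_def r_def)
    fix p q assume "p \<in> A" "q \<in> A"
    moreover then have "(sup (fst p) (fst q), 0) \<in> A"
      using cl by (auto simp: A_def inf_absorb2 le_supI1)
    ultimately show "\<exists>c\<in>A. (p, c) \<in> r \<and> (q, c) \<in> r"
      by (intro bexI[of _ "(sup (fst p) (fst q), 0)"]) (auto simp: r_def)
  qed
  have "uo_conv X A r snd 0"
    unfolding uo_conv_def
  proof (intro ballI impI)
    fix w assume w: "w \<in> X" "0 \<le> w"
    \<comment> \<open>Beyond the index \<open>(w, 0)\<close> all elements are disjoint from
      \<open>w\<close>, so the truncations by \<open>w\<close> vanish and \<open>{0}\<close>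
      witnesses the order convergence.\<close>
    have "down_to_0 X {0}" using cl(1) by (auto simp: down_to_0_def)
    moreover have w0: "(w, 0) \<in> A" using w cl by (auto simp: A_def inf_absorb2)
    moreover have "\<bar>0 - (inf \<bar>snd q - 0\<bar> w)\<bar> \<le> 0" if "((w, 0), q) \<in> r" for q
    proof -
      have "inf \<bar>snd q\<bar> w = 0"
        using that w by (intro disjoint_mono[of "\<bar>snd q\<bar>" w "\<bar>snd q\<bar>" "fst q"])
          (auto simp: r_def A_def inf_commute)
      then show ?thesis by simp
    qed
    ultimately show "order_conv X A r (\<lambda>a. inf \<bar>snd a - 0\<bar> w) 0"
      unfolding order_conv_iff_set[OF X] by blast
  qed
  from limitin_zero_nbhd[OF X lin uo_Lebesgue_topologyD[OF uoL dir _ cl(1) this] V]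
  have "eventually (\<lambda>a. snd a \<in> V) (net_filter A r)" by (force simp: A_def)
  then obtain y x0 where yx: "(y, x0) \<in> A" "\<forall>b\<in>A. ((y, x0), b) \<in> r \<longrightarrow> snd b \<in> V"
    unfolding eventually_net_filter[OF dir] by auto
  show thesis
  proof (rule that)
    show "y \<in> X" "0 \<le> y" using yx by (auto simp: A_def)
    fix x assume "x \<in> X" "0 \<le> x" "inf y x = 0"
    then have "(y, x) \<in> A" using yx(1) by (auto simp: A_def)
    with yx show "x \<in> V" by (auto simp: r_def)
  qed
qed

text \<open>An element \<open>e\<close> below all eventual upper bounds of the sequence of the \<open>inf (b k) w\<close> lies in
  every \<open>U m\<close>: the gap between the finite suprema of a tail and its upper bounds is downward
  directed to \<open>0\<close>, and the finite suprema of the tail are in \<open>U (Suc m)\<close>.\<close>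

lemma uo_conv_of_nbhd_chain:
  assumes U: "nbhd_chain X \<tau> U" and b: "\<And>k. b k \<in> U k" "\<And>k. 0 \<le> b k"
    and null: "\<And>e k. e \<in> chain_null X U \<Longrightarrow> inf e (b k) = 0"
  shows "uo_conv X UNIV nat_order b 0"
  unfolding uo_conv_def
proof (intro ballI impI)
  note cl = sublattice_closed[OF X]
  fix w assume w: "w \<in> X" "0 \<le> w"
  have bX: "b k \<in> X" for k using b nbhd_chainD(4)[OF U] by blast
  \<comment> \<open>Each member of \<open>D\<close> eventually bounds the truncations, so it remains
    to see that the infimum of \<open>D\<close> is 0.\<close>
  define D where "D = {d \<in> X. \<exists>m. \<forall>k\<ge>m. inf (b k) w \<le> d}"
  have wD: "w \<in> D" using w by (auto simp: D_def)
  have D_pos: "0 \<le> d" if "d \<in> D" for d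
  proof -
    obtain m where "inf (b m) w \<le> d" using \<open>d \<in> D\<close> by (auto simp: D_def)
    moreover have "0 \<le> inf (b m) w" using b w by simp
    ultimately show ?thesis by (rule order_trans[rotated])
  qed
  have inU: "e \<in> U m" if e: "e \<in> X" "0 \<le> e" "\<forall>d\<in>D. e \<le> d" for e m
  proof -
    \<comment> \<open>Partial sums replace finite suprema: they dominate each of their terms and
      stay in \<open>U (Suc m)\<close>, because they start at the index \<open>Suc (Suc m)\<close>.
      The remaining level is spent on adding \<open>d - a\<close> and \<open>a\<close>.\<close>
    let ?s = "\<lambda>N. \<Sum>k<N. b (Suc (Suc m + k))"
    define A where "A = {a \<in> X. 0 \<le> a \<and> a \<le> w \<and> (\<exists>N. a \<le> ?s N)}"
    have s_mono: "?s N \<le> ?s M" if "N \<le> M" for N M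
      using that b by (intro sum_mono2) auto
    have s0: "0 \<le> ?s N" for N using b by (intro sum_nonneg) auto
    have "down_to_0 X {d - a | d a. d \<in> X \<and> (\<forall>b\<in>A. b \<le> d) \<and> a \<in> A}"
    proof (rule down_to_0_gap[OF X _ _ _ w(1)])
      show "A \<subseteq> X" by (auto simp: A_def)
      have "0 \<in> A" using w cl(1) s0[of 0] unfolding A_def by blast
      then show "A \<noteq> {}" by blast
      show "a \<le> w" if "a \<in> A" for a using that by (simp add: A_def)
      fix x y assume xy: "x \<in> A" "y \<in> A"
      then obtain N M where "x \<le> ?s N" "y \<le> ?s M" unfolding A_def by blast
      then have "sup x y \<le> ?s (max N M)"
        using order_trans[OF _ s_mono[OF max.cobounded1]] order_trans[OF _ s_mono[OF max.cobounded2]]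
        by (intro sup_least) blast+
      moreover have "sup x y \<in> X \<and> 0 \<le> sup x y \<and> sup x y \<le> w"
        using xy cl(7) by (simp add: A_def le_supI1)
      ultimately have "sup x y \<in> A" unfolding A_def by blast
      then show "\<exists>c\<in>A. x \<le> c \<and> y \<le> c" by (metis sup_ge1 sup_ge2)
    qed
    from down_to_0_zero_nbhd[OF this nbhd_chainD(2)[OF U, of "Suc m"]]
    obtain d a where da: "d \<in> X" "\<forall>b\<in>A. b \<le> d" "a \<in> A" "d - a \<in> U (Suc m)" by blast
    have "inf (b k) w \<in> A" if "k \<ge> Suc (Suc m)" for k
    proof -
      define j where "j = k - Suc (Suc m)"
      have k: "k = Suc (Suc m + j)" using that by (simp add: j_def)
      have "?s (Suc j) = ?s j + b k" by (simp add: k)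
      then have "b k \<le> ?s (Suc j)" using s0[of j] by simp
      then have "inf (b k) w \<le> ?s (Suc j)" by (rule le_infI1)
      moreover have "inf (b k) w \<in> X \<and> 0 \<le> inf (b k) w \<and> inf (b k) w \<le> w"
        using b(2)[of k] w cl(6)[OF bX] by simp
      ultimately show ?thesis unfolding A_def by blast
    qed
    then have "\<forall>k\<ge>Suc (Suc m). inf (b k) w \<le> d" using da(2) by blast
    then have "d \<in> D" using da(1) unfolding D_def by blast
    then have "e \<le> d" using e by blast
    obtain N where "a \<le> ?s N" "0 \<le> a" "a \<in> X" using da(3) unfolding A_def by blast
    moreover have "?s N \<in> U (Suc m)" using nbhd_chain_sum[where b = b, OF U b(1)] by blast
    ultimately have "a \<in> U (Suc m)" using nbhd_chainD(6)[OF U, of a "?s N"] s0[of N] by simp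
    then have "d - a + a \<in> U m" using nbhd_chainD(5)[OF U da(4)] by blast
    then have "d \<in> U m" by simp
    moreover have "\<bar>e\<bar> \<le> \<bar>d\<bar>" using order_trans[OF e(2) \<open>e \<le> d\<close>] e(2) \<open>e \<le> d\<close> by simp
    ultimately show ?thesis using nbhd_chainD(6)[OF U e(1)] by blast
  qed
  have "down_to_0 X D"
    unfolding down_to_0_def
  proof (intro conjI ballI impI)
    show "D \<subseteq> X" "D \<noteq> {}" "\<And>d. d \<in> D \<Longrightarrow> 0 \<le> d" using wD D_pos by (auto simp: D_def)
    show "\<exists>c\<in>D. c \<le> p \<and> c \<le> q" if "p \<in> D" "q \<in> D" for p q
    proof -
      obtain m m' where "\<forall>k\<ge>m. inf (b k) w \<le> p" "\<forall>k\<ge>m'. inf (b k) w \<le> q" "p \<in> X" "q \<in> X"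
        using \<open>p \<in> D\<close> \<open>q \<in> D\<close> by (auto simp: D_def)
      then have "inf p q \<in> D" using cl
        by (auto simp: D_def intro!: exI[of _ "max m m'"])
      then show ?thesis by (metis inf_le1 inf_le2)
    qed
    fix e assume e: "e \<in> X" "0 \<le> e" "\<forall>d\<in>D. e \<le> d"
    have "e \<in> chain_null X U" using e inU[OF e] by (simp add: chain_null_def)
    then have disj: "inf e (b k) = 0" for k by (rule null)
    show "e = 0"
    proof (rule archimedean_descend[OF wD _ D_pos e(2)])
      fix d assume d: "d \<in> D"
      then obtain m where m: "d \<in> X" "\<forall>k\<ge>m. inf (b k) w \<le> d" by (auto simp: D_def)
      \<comment> \<open>The truncation and \<open>e\<close> are disjoint and both below
        \<open>d\<close>, so their sum is below \<open>d\<close>. Hence \<open>D\<close> is closed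
        under subtracting \<open>e\<close>.\<close>
      have "inf (b k) w \<le> d - e" if "k \<ge> m" for k
      proof -
        have "inf (inf (b k) w) e = 0"
          using disj[of k] e b w
          by (intro disjoint_mono[of "inf (b k) w" e "b k" e]) (auto simp: inf_commute)
        from disjoint_add_le[OF this] m that d e have "inf (b k) w + e \<le> d" by blast
        then show ?thesis by (simp only: le_diff_eq)
      qed
      then show "d - e \<in> D" using m cl(3) e by (auto simp: D_def)
    qed
  qed
  moreover have "\<bar>0 - (inf \<bar>b k - 0\<bar> w)\<bar> = inf (b k) w" for k using b w by simp
  ultimately show "order_conv X UNIV nat_order (\<lambda>k. inf \<bar>b k - 0\<bar> w) 0"
    unfolding order_conv_iff_set[OF X] by (intro exI[of _ D]) (auto simp: D_def)
qed

section \<open>Chains that separate order intervals from 0\<close>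

text \<open>Take a chain with \<open>h\<close> outside \<open>U 0\<close>. If every \<open>c\<close>
  between 0 and \<open>h\<close> met a null element, the null elements below \<open>h\<close> would
  approach \<open>h\<close>, so \<open>h - e\<close> would be in \<open>U 1\<close> for some null
  \<open>e\<close>. But \<open>e\<close> is in \<open>U 1\<close> too, which puts \<open>h\<close>
  into \<open>U 0\<close>.\<close>

lemma Hausdorff_chain_disjoint:
  assumes Haus: "Hausdorff_space \<tau>" and h: "h \<in> X" "0 < h"
  obtains U c where "nbhd_chain X \<tau> U" "c \<in> X" "0 < c" "c \<le> h"
    "\<And>e. e \<in> chain_null X U \<Longrightarrow> inf e c = 0"
proof (rule ccontr)
  assume no: "\<not> thesis"
  note witness = that and cl = sublattice_closed[OF X]
  have "topspace \<tau> = X" using lin by (simp add: linear_topology_def)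
  then obtain V where V: "zero_nbhd \<tau> V" "h \<notin> V"
    using Hausdorff_zero_nbhd[OF Haus, of h] h cl(1) by auto
  obtain U where U: "nbhd_chain X \<tau> U" "U 0 \<subseteq> V"
    using nbhd_chain_exists[OF X ls, of "\<lambda>_. V"] V by metis
  have meet: "\<exists>e\<in>chain_null X U. inf e c \<noteq> 0" if "c \<in> X" "0 < c" "c \<le> h" for c
    using no witness[OF U(1) that] by blast
  let ?Z = "{h - e | e. e \<in> chain_null X U \<and> e \<le> h}"
  have "down_to_0 X ?Z"
    unfolding down_to_0_def
  proof (intro conjI ballI impI)
    show "?Z \<subseteq> X" using h cl by (auto simp: chain_null_def)
    show "?Z \<noteq> {}" using h cl nbhd_chainD(3)[OF U(1)] by (auto simp: chain_null_def intro: exI[of _ 0])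
    show "\<And>z. z \<in> ?Z \<Longrightarrow> 0 \<le> z" by auto
    show "\<exists>c\<in>?Z. c \<le> p \<and> c \<le> q" if pq: "p \<in> ?Z" "q \<in> ?Z" for p q
    proof -
      from pq obtain e f where ef: "p = h - e" "q = h - f" "e \<in> chain_null X U"
        "f \<in> chain_null X U" "e \<le> h" "f \<le> h" by blast
      have "sup e f \<in> chain_null X U"
        using ef cl chain_null_mono[OF U(1) chain_null_add[OF X U(1) ef(3,4)], of "sup e f"]
        by (auto simp: chain_null_def le_supI1 add_increasing add_increasing2)
      moreover have "sup e f \<le> h" using ef by simp
      ultimately have "h - sup e f \<in> ?Z" by blast
      moreover have "h - sup e f \<le> p" "h - sup e f \<le> q"
        unfolding ef by (intro diff_left_mono sup_ge1 sup_ge2)+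
      ultimately show ?thesis by blast
    qed
    fix g assume g: "g \<in> X" "0 \<le> g" "\<forall>z\<in>?Z. g \<le> z"
    have ge: "e + g \<le> h" if "e \<in> chain_null X U" "e \<le> h" for e
      using g(3) that by (force simp: le_diff_eq add.commute)
    have z: "0 \<in> chain_null X U" using cl nbhd_chainD(3)[OF U(1)] by (simp add: chain_null_def)
    show "g = 0"
    proof (rule ccontr)
      assume "g \<noteq> 0"
      then have "0 < g" using g(2) by simp
      moreover have "g \<le> h" using ge[OF z] h by simp
      ultimately obtain e where e: "e \<in> chain_null X U" "inf e g \<noteq> 0"
        using meet[OF g(1)] by blast
      have c: "inf e g \<in> chain_null X U"
        using chain_null_mono[OF U(1) e(1), of "inf e g"] e g cl by (auto simp: chain_null_def)
      \<comment> \<open>Adding the null element \<open>inf e g\<close> to a null \<open>f\<close>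
        below \<open>h\<close> keeps it null, and it stays below \<open>h\<close> since
        \<open>f + g \<le> h\<close>. So \<open>?Z\<close> is closed under subtracting
        \<open>inf e g\<close>.\<close>
      have "inf e g = 0"
      proof (rule archimedean_descend[of h ?Z _ 0])
        show "h \<in> ?Z" using z h by force
        fix d assume "d \<in> ?Z"
        then obtain f where f: "d = h - f" "f \<in> chain_null X U" "f \<le> h" by blast
        have "f + inf e g \<le> f + g" by (intro add_left_mono) simp
        then have "f + inf e g \<le> h" using ge[OF f(2,3)] by (rule order_trans)
        moreover have "f + inf e g \<in> chain_null X U" by (rule chain_null_add[OF X U(1) f(2) c])
        ultimately show "d - inf e g \<in> ?Z" unfolding f(1) diff_diff_add by blast
      qed (use c in \<open>auto simp: chain_null_def\<close>)
      with e show False by blast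
    qed
  qed
  from down_to_0_zero_nbhd[OF this nbhd_chainD(2)[OF U(1), of 1]]
  obtain e where "e \<in> chain_null X U" "h - e \<in> U 1" by blast
  then have "h - e + e \<in> U 0" using nbhd_chainD(5)[OF U(1), of "h - e" 0 e]
    by (simp add: chain_null_def)
  with U V show False by auto
qed

end

text \<open>\<open>prod_decode\<close> lists the members of all the chains as one sequence of
  neighbourhoods, and a single chain is chosen below that sequence.\<close>

lemma nbhd_chain_refine:
  fixes W :: "nat \<Rightarrow> nat \<Rightarrow> 'a::archimedean_vector_lattice set"
  assumes X: "vector_sublattice X" and ls: "locally_solid_topology X \<tau>"
    and W: "\<And>i. nbhd_chain X \<tau> (W i)"
  obtains U where "nbhd_chain X \<tau> U" "\<And>i. chain_null X U \<subseteq> chain_null X (W i)"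
proof -
  obtain U where U: "nbhd_chain X \<tau> U"
    "\<And>n. U n \<subseteq> W (fst (prod_decode n)) (snd (prod_decode n))"
    using nbhd_chain_exists[OF X ls, of "\<lambda>n. W (fst (prod_decode n)) (snd (prod_decode n))"]
      nbhd_chainD(2)[OF W] by blast
  have "U (prod_encode (i, j)) \<subseteq> W i j" for i j using U(2)[of "prod_encode (i, j)"] by simp
  then have "chain_null X U \<subseteq> chain_null X (W i)" for i unfolding chain_null_def by blast
  with U(1) show thesis by (rule that)
qed

text \<open>With the countable sup property, countably many neighbourhoods suffice to separate
  the elements of \<open>{0..y}\<close> from \<open>0\<close>: the elements of \<open>{0..y}\<close> disjoint from all null elements
  of some chain have supremum \<open>y\<close>, and countably many of them have the same supremum.\<close>

lemma separating_nbhd_chain: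
  assumes csp: "countable_sup_property (UNIV :: 'a::archimedean_vector_lattice set)"
    and G: "regular_sublattice (G :: 'a set)" and uoL: "uo_Lebesgue_topology G \<tau>"
    and Haus: "Hausdorff_space \<tau>" and y: "y \<in> G" "0 \<le> y"
  obtains U where "nbhd_chain G \<tau> U" "\<And>e. e \<in> chain_null G U \<Longrightarrow> e \<le> y \<Longrightarrow> e = 0"
proof -
  have X: "vector_sublattice G" using G by (simp add: regular_sublattice_def)
  have ls: "locally_solid_topology G \<tau>" using uoL by (simp add: uo_Lebesgue_topology_def)
  note cl = sublattice_closed[OF X]
  define ann where "ann U = {c \<in> G. 0 \<le> c \<and> c \<le> y \<and> (\<forall>e\<in>chain_null G U. inf e c = 0)}" for U
  define S where "S = \<Union> (ann ` {U. nbhd_chain G \<tau> U})"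
  have null_pos: "0 \<le> e" if "e \<in> chain_null G U" for e U using that by (simp add: chain_null_def)
  obtain U0 where U0: "nbhd_chain G \<tau> U0"
  proof -
    have "openin \<tau> G" "0 \<in> G" using ls cl(1) openin_topspace[of \<tau>]
      by (auto simp: locally_solid_topology_def linear_topology_def)
    then have nb: "zero_nbhd \<tau> G" unfolding zero_nbhd_def by blast
    show thesis by (rule nbhd_chain_exists[OF X ls nb], rule that)
  qed
  have zero_ann: "0 \<in> ann U" for U using cl(1) y null_pos by (auto simp: ann_def inf_absorb2)
  have zero_S: "0 \<in> S" using zero_ann U0 by (auto simp: S_def)
  let ?Z = "{y - c | c. c \<in> S}"
  have Z: "down_to_0 G ?Z"
    unfolding down_to_0_def
  proof (intro conjI ballI impI)
    show "?Z \<subseteq> G" "\<And>z. z \<in> ?Z \<Longrightarrow> 0 \<le> z" using y cl(3) by (auto simp: S_def ann_def)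
    show "?Z \<noteq> {}" using zero_S by blast
    show "\<exists>c\<in>?Z. c \<le> p \<and> c \<le> q" if pq: "p \<in> ?Z" "q \<in> ?Z" for p q
    proof -
      from pq obtain c d U U' where *: "p = y - c" "q = y - d" "nbhd_chain G \<tau> U"
        "nbhd_chain G \<tau> U'" "c \<in> ann U" "d \<in> ann U'" by (auto simp: S_def)
      define W where "W i = (if i = (0::nat) then U else U')" for i
      have W: "nbhd_chain G \<tau> (W i)" for i using * by (simp add: W_def)
      obtain V where V: "nbhd_chain G \<tau> V" "\<And>i. chain_null G V \<subseteq> chain_null G (W i)"
        by (rule nbhd_chain_refine[OF X ls W], rule that)
      have sub: "chain_null G V \<subseteq> chain_null G U" "chain_null G V \<subseteq> chain_null G U'"
        using V(2)[of 0] V(2)[of 1] by (simp_all add: W_def)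
      have "inf e (sup c d) = 0" if "e \<in> chain_null G V" for e
        using that sub * null_pos[OF that] by (intro disjoint_sup) (auto simp: ann_def)
      moreover have "sup c d \<in> G" "0 \<le> sup c d" "sup c d \<le> y"
        using * cl(7) by (auto simp: ann_def le_supI1)
      ultimately have "sup c d \<in> ann V" by (simp add: ann_def)
      then have "sup c d \<in> S" using V(1) by (auto simp: S_def)
      moreover have "y - sup c d \<le> p" "y - sup c d \<le> q"
        unfolding * by (intro diff_left_mono sup_ge1 sup_ge2)+
      ultimately show ?thesis by blast
    qed
    fix g assume g: "g \<in> G" "0 \<le> g" "\<forall>z\<in>?Z. g \<le> z"
    have ge: "c + g \<le> y" if "c \<in> S" for c
    proof -
      have "g \<le> y - c" using g(3) that by blast
      then show ?thesis by (simp add: le_diff_eq add.commute)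
    qed
    show "g = 0"
    proof (rule ccontr)
      assume "g \<noteq> 0"
      with g have "0 < g" by simp
      from Hausdorff_chain_disjoint[OF X uoL Haus g(1) this]
      obtain U c where U: "nbhd_chain G \<tau> U" and c: "c \<in> G" "0 < c" "c \<le> g"
        "\<And>e. e \<in> chain_null G U \<Longrightarrow> inf e c = 0" by blast
      \<comment> \<open>With \<open>U\<close> fixed, adding \<open>c\<close> does not leave
        \<open>ann U\<close>: disjointness from the null elements is additive, and the sum stays
        below \<open>y\<close> because \<open>c \<le> g\<close> and \<open>g\<close> is below every
        difference \<open>y - d\<close>.\<close>
      have "c = 0"
      proof (rule archimedean_descend[of y "{y - d | d. d \<in> ann U}" _ 0])
        show "y \<in> {y - d | d. d \<in> ann U}" using zero_ann[of U] by force
        show "0 \<le> c" using c by simp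
        show "\<And>d. d \<in> {y - d |d. d \<in> ann U} \<Longrightarrow> 0 \<le> d" by (auto simp: ann_def)
        fix x assume "x \<in> {y - d | d. d \<in> ann U}"
        then obtain d where d: "x = y - d" "d \<in> ann U" by blast
        have "d \<in> S" using d U by (auto simp: S_def)
        have "inf e (d + c) = 0" if "e \<in> chain_null G U" for e
          using c d(2) that null_pos[OF that] by (intro disjoint_add) (auto simp: ann_def)
        moreover have "d + c \<le> y"
          using add_left_mono[OF c(3), of d] ge[OF \<open>d \<in> S\<close>] by (rule order_trans)
        ultimately have "d + c \<in> ann U" using d(2) c cl(2) by (simp add: ann_def)
        then show "x - c \<in> {y - d | d. d \<in> ann U}" unfolding d(1) diff_diff_add by blast
      qed
      with c show False by simp
    qed
  qed
  \<comment> \<open>The upper bounds \<open>z\<close> range over all of \<open>E\<close> here, so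
    \<open>y - inf z y\<close> need not be in \<open>G\<close>; regularity still makes it 0.\<close>
  have "isLub UNIV S y"
  proof (intro isLubI2 isUb_UNIV_I setgeI ballI)
    show "c \<le> y" if "c \<in> S" for c using that by (auto simp: S_def ann_def)
    fix z assume "z \<in> Collect (isUb UNIV S)"
    then have z: "\<And>c. c \<in> S \<Longrightarrow> c \<le> z" by (auto dest: isUbD)
    have "\<forall>d\<in>?Z. y - inf z y \<le> d"
    proof
      fix d assume "d \<in> ?Z"
      then obtain c where "d = y - c" "c \<in> S" by blast
      moreover have "c \<le> y" using \<open>c \<in> S\<close> by (auto simp: S_def ann_def)
      ultimately show "y - inf z y \<le> d" using z[of c]
        by (simp only: diff_left_mono inf_greatest)
    qed
    moreover have "0 \<le> y - inf z y" by (simp only: diff_ge_0_iff_ge inf_le2)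
    ultimately have "y - inf z y = 0"
      using regular_down_to_0[OF G Z] unfolding down_to_0_def by blast
    then have "inf z y = y" by (simp only: right_minus_eq)
    then show "y \<le> z" by (metis inf_le1)
  qed
  then obtain C where C: "C \<subseteq> S" "countable C" "isLub UNIV C y"
    using csp zero_S unfolding countable_sup_property_def by blast
  define ch where "ch c = (SOME U. nbhd_chain G \<tau> U \<and> c \<in> ann U)" for c
  have ch: "nbhd_chain G \<tau> (ch c)" "c \<in> ann (ch c)" if "c \<in> insert 0 C" for c
  proof -
    have "\<exists>U. nbhd_chain G \<tau> U \<and> c \<in> ann U" using that C(1) zero_S by (auto simp: S_def)
    then have "nbhd_chain G \<tau> (ch c) \<and> c \<in> ann (ch c)" unfolding ch_def by (rule someI_ex)
    then show "nbhd_chain G \<tau> (ch c)" "c \<in> ann (ch c)" by auto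
  qed
  \<comment> \<open>Inserting \<open>0\<close>, a member of \<open>S\<close>, makes the countable
    set nonempty and thus the range of a sequence.\<close>
  define c where "c = from_nat_into (insert 0 C)"
  have c: "range c = insert 0 C" unfolding c_def using C(2) by (simp add: range_from_nat_into)
  have chc: "nbhd_chain G \<tau> (ch (c i))" for i using ch(1) c by blast
  obtain U where U: "nbhd_chain G \<tau> U" "\<And>i. chain_null G U \<subseteq> chain_null G (ch (c i))"
    by (rule nbhd_chain_refine[OF X ls chc], rule that)
  show thesis
  proof (rule that[OF U(1)])
    fix e assume e: "e \<in> chain_null G U" "e \<le> y"
    have "a \<le> y - e" if "a \<in> C" for a
    proof -
      have "a \<in> range c" using that c by simp
      then obtain i where i: "a = c i" by blast
      have "a \<in> ann (ch (c i))" using ch(2)[of a] that i by simp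
      moreover have "e \<in> chain_null G (ch (c i))" using U(2) e(1) by blast
      ultimately have "inf a e = 0" "a \<le> y" by (auto simp: ann_def inf_commute)
      from disjoint_add_le[OF this e(2)] show ?thesis by (simp only: le_diff_eq)
    qed
    then have "y \<le> y - e" using isLub_le_isUb[OF C(3) isUb_UNIV_I] by blast
    then show "e = 0" using null_pos[OF e(1)] by simp
  qed
qed

section \<open>Comparison of two uo-Lebesgue topologies\<close>

text \<open>Uo-convergence mentions no topology and so carries smallness of the truncations
  \<open>b k\<close> from \<tau> to \<sigma>. The other two pieces of the modulus of
  \<open>x k\<close> are small in \<sigma> by the choice of \<open>y\<close> and of
  \<open>n k\<close>. Used in both directions, this gives uniqueness.\<close>

lemma uo_Lebesgue_topology_minimal:
  assumes csp: "countable_sup_property (UNIV :: 'a::archimedean_vector_lattice set)"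
    and G: "regular_sublattice (G :: 'a set)" and \<tau>: "uo_Lebesgue_topology G \<tau>" "Hausdorff_space \<tau>"
    and \<sigma>: "uo_Lebesgue_topology G \<sigma>" and V: "zero_nbhd \<sigma> V"
  shows "zero_nbhd \<tau> V"
proof (rule ccontr)
  assume no: "\<not> zero_nbhd \<tau> V"
  have X: "vector_sublattice G" using G by (simp add: regular_sublattice_def)
  have ls: "locally_solid_topology G \<sigma>" using \<sigma> by (simp add: uo_Lebesgue_topology_def)
  note cl = sublattice_closed[OF X]
  obtain W where W: "nbhd_chain G \<sigma> W" "W 0 \<subseteq> V"
    by (rule nbhd_chain_exists[OF X ls V], rule that)
  \<comment> \<open>Level 2, because three pieces are added up at the end: \<open>b k + c k\<close>
    lands in \<open>W 1\<close>, and adding the error lands in \<open>W 0\<close>.\<close>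
  obtain y where y: "y \<in> G" "0 \<le> y" "\<And>x. x \<in> G \<Longrightarrow> 0 \<le> x \<Longrightarrow> inf y x = 0 \<Longrightarrow> x \<in> W 2"
    by (rule disjoint_in_zero_nbhd[OF X \<sigma> nbhd_chainD(2)[OF W(1), of 2]], rule that)
  obtain U where U: "nbhd_chain G \<tau> U" "\<And>e. e \<in> chain_null G U \<Longrightarrow> e \<le> y \<Longrightarrow> e = 0"
    by (rule separating_nbhd_chain[OF csp G \<tau> y(1,2)], rule that)
  have "\<exists>x. x \<in> U k \<and> x \<notin> V" for k
    using no zero_nbhd_mono[OF nbhd_chainD(2)[OF U(1)]] by blast
  then obtain x where x: "\<And>k. x k \<in> U k" "\<And>k. x k \<notin> V" by metis
  have xG: "x k \<in> G" for k using x(1) nbhd_chainD(4)[OF U(1)] by blast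
  have "\<exists>n c. c \<in> G \<and> 0 \<le> c \<and> inf y c = 0 \<and>
    \<bar>x k\<bar> - (inf \<bar>x k\<bar> (real n *\<^sub>R y) + c) \<in> W 2" for k
    by (rule down_to_0_zero_nbhd[OF X \<sigma>
          down_to_0_disjoint_decomposition[OF X cl(8)[OF xG] abs_ge_zero y(1,2)]
          nbhd_chainD(2)[OF W(1), of 2]]) blast
  then obtain n c where nc: "\<And>k. c k \<in> G" "\<And>k. 0 \<le> c k" "\<And>k. inf y (c k) = 0"
    "\<And>k. \<bar>x k\<bar> - (inf \<bar>x k\<bar> (real (n k) *\<^sub>R y) + c k) \<in> W 2" by metis
  define b where "b k = inf \<bar>x k\<bar> (real (n k) *\<^sub>R y)" for k
  have b: "0 \<le> b k" "b k \<in> G" for k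
    using y cl xG by (auto simp: b_def scaleR_nonneg_nonneg)
  have "uo_conv G UNIV nat_order b 0"
  proof (rule uo_conv_of_nbhd_chain[OF X \<tau>(1) U(1)])
    show "b k \<in> U k" for k
      using nbhd_chainD(6)[OF U(1) b(2) x(1)] b(1) by (simp add: b_def)
    \<comment> \<open>\<open>U\<close> separates only \<open>{0..y}\<close> from 0, which is why
      \<open>x k\<close> was truncated by multiples of \<open>y\<close>: null elements are disjoint
      from \<open>y\<close>, hence from those multiples.\<close>
    show "inf e (b k) = 0" if e: "e \<in> chain_null G U" for e k
    proof -
      have e': "e \<in> G" "0 \<le> e" using e by (auto simp: chain_null_def)
      have "inf e y \<in> chain_null G U"
        using chain_null_mono[OF U(1) e, of "inf e y"] e' y cl by simp
      then have "inf e y = 0" using U(2) by simp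
      then have "inf e (real (n k) *\<^sub>R y) = 0" using disjoint_scale e' y by blast
      then show ?thesis
        using e' b(1)[of k] by (intro disjoint_mono[of e "b k" e]) (auto simp: b_def)
    qed
  qed (rule b(1))
  moreover have "b ` UNIV \<subseteq> G" using b(2) by blast
  ultimately obtain k where "b k - 0 \<in> W 2"
    using uo_Lebesgue_zero_nbhd[OF X \<sigma> directed_index_nat _ cl(1) _ nbhd_chainD(2)[OF W(1), of 2]]
    by metis
  moreover have "c k \<in> W 2" using y(3) nc by blast
  ultimately have "b k + c k \<in> W 1" using nbhd_chainD(5)[OF W(1), of "b k" 1 "c k"]
    by (simp add: numeral_2_eq_2)
  moreover have "\<bar>x k\<bar> - (b k + c k) \<in> W 1"
    using nc(4)[of k] nbhd_chain_Suc_subset[OF W(1), of 1]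
    by (auto simp: b_def numeral_2_eq_2)
  ultimately have "\<bar>x k\<bar> - (b k + c k) + (b k + c k) \<in> W 0"
    using nbhd_chainD(5)[OF W(1), of _ 0] by (simp only: One_nat_def)
  then have "\<bar>x k\<bar> \<in> W 0" by simp
  then have "x k \<in> W 0" using nbhd_chainD(6)[OF W(1) xG] by simp
  with x W show False by blast
qed

section \<open>From topological convergence of sequences to uo-convergence\<close>

text \<open>One chain is made to separate all the intervals \<open>{0..b n}\<close> from 0, so its
  null elements are disjoint from every \<open>b n\<close>. The selection \<open>q\<close> then only
  has to put the k-th term into \<open>U k\<close>; it is not made increasing.\<close>

lemma uo_convergent_subsequence:
  assumes csp: "countable_sup_property (UNIV :: 'a::archimedean_vector_lattice set)"
    and G: "regular_sublattice (G :: 'a set)" and \<tau>: "uo_Lebesgue_topology G \<tau>" "Hausdorff_space \<tau>"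
    and z: "range z \<subseteq> G" "l \<in> G" and lim: "limitin \<tau> z l sequentially"
  obtains q :: "nat \<Rightarrow> nat" where "uo_conv G UNIV nat_order (\<lambda>k. z (q k)) l"
proof -
  have X: "vector_sublattice G" using G by (simp add: regular_sublattice_def)
  have ls: "locally_solid_topology G \<tau>" and lin: "linear_topology G \<tau>"
    using \<tau> by (auto simp: uo_Lebesgue_topology_def locally_solid_topology_def)
  note cl = sublattice_closed[OF X]
  define b where "b n = \<bar>z n - l\<bar>" for n
  have b: "b n \<in> G" "0 \<le> b n" for n
    using cl(8)[OF cl(3)[OF _ z(2)]] z(1) by (auto simp: b_def)
  have "\<exists>W. nbhd_chain G \<tau> W \<and> (\<forall>e. e \<in> chain_null G W \<longrightarrow> e \<le> b n \<longrightarrow> e = 0)" for n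
    by (rule separating_nbhd_chain[OF csp G \<tau> b[of n]]) blast
  then obtain W where W: "\<And>n. nbhd_chain G \<tau> (W n)"
    "\<And>n e. e \<in> chain_null G (W n) \<Longrightarrow> e \<le> b n \<Longrightarrow> e = 0" by metis
  obtain U where U: "nbhd_chain G \<tau> U" "\<And>n. chain_null G U \<subseteq> chain_null G (W n)"
    by (rule nbhd_chain_refine[OF X ls W(1)], rule that)
  have "\<exists>n. z n - l \<in> U k" for k
    using limitin_zero_nbhd[OF X lin lim nbhd_chainD(2)[OF U(1)], of k]
    by (auto simp: eventually_sequentially)
  then obtain q where q: "\<And>k. z (q k) - l \<in> U k" by metis
  have "uo_conv G UNIV nat_order (\<lambda>k. b (q k)) 0"
  proof (rule uo_conv_of_nbhd_chain[OF X \<tau>(1) U(1)])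
    show "b (q k) \<in> U k" for k using nbhd_chainD(6)[OF U(1) b(1) q] by (simp add: b_def)
    show "inf e (b (q k)) = 0" if e: "e \<in> chain_null G U" for e k
    proof -
      have e': "e \<in> chain_null G (W (q k))" "e \<in> G" "0 \<le> e"
        using e U(2) by (auto simp: chain_null_def)
      then have "inf e (b (q k)) \<in> chain_null G (W (q k))"
        using chain_null_mono[OF W(1) e'(1), of "inf e (b (q k))"] b cl(6) by simp
      then show ?thesis using W(2) by simp
    qed
  qed (rule b(2))
  then have "uo_conv G UNIV nat_order (\<lambda>k. z (q k)) l" by (simp add: uo_conv_def b_def)
  then show thesis by (rule that)
qed

lemma uo_conv_of_topological:
  assumes csp: "countable_sup_property (UNIV :: 'a::archimedean_vector_lattice set)"
    and G: "regular_sublattice (G :: 'a set)" and \<tau>: "uo_Lebesgue_topology G \<tau>" "Hausdorff_space \<tau>"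
    and top: "topspace T = G" and uo: "\<And>x l. range x \<subseteq> G \<Longrightarrow> l \<in> G \<Longrightarrow>
           uo_conv G UNIV nat_order x l \<longleftrightarrow> limitin T x l sequentially"
    and x: "range x \<subseteq> G" "l \<in> G" and lim: "limitin \<tau> x l sequentially"
  shows "uo_conv G UNIV nat_order x l"
proof (rule ccontr)
  assume "\<not> ?thesis"
  then have "\<not> limitin T x l sequentially" using uo x by blast
  then obtain A where A: "openin T A" "l \<in> A" "\<not> (\<forall>\<^sub>F n in sequentially. x n \<in> A)"
    using x(2) top by (auto simp: limitin_def)
  then have "\<forall>N. \<exists>n\<ge>N. x n \<notin> A" by (auto simp: eventually_sequentially)
  \<comment> \<open>All terms along \<open>r\<close> avoid \<open>A\<close>, so any selection from
    them does too; convergence in \<open>T\<close> of even one such selection is a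
    contradiction.\<close>
  then obtain r where r: "\<And>N. r N \<ge> N" "\<And>N. x (r N) \<notin> A" by metis
  have "filterlim r at_top sequentially"
    by (rule filterlim_at_top_mono[OF filterlim_ident]) (simp add: r(1))
  then have "limitin \<tau> (\<lambda>n. x (r n)) l sequentially"
    using lim by (auto simp: limitin_def filterlim_iff)
  moreover have "range (\<lambda>n. x (r n)) \<subseteq> G" using x by blast
  ultimately obtain q where q: "uo_conv G UNIV nat_order (\<lambda>k. x (r (q k))) l"
    using uo_convergent_subsequence[OF csp G \<tau> _ x(2)] by blast
  then have "limitin T (\<lambda>k. x (r (q k))) l sequentially"
    using uo[of "\<lambda>k. x (r (q k))" l] x by blast
  then have "\<forall>\<^sub>F k in sequentially. x (r (q k)) \<in> A" using A unfolding limitin_def by blast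
  then show False using r(2) by simp
qed

lemma uo_Lebesgue_limitin_sequentially:
  assumes "uo_Lebesgue_topology G \<tau>" "range x \<subseteq> G" "l \<in> G" "uo_conv G UNIV nat_order x l"
  shows "limitin \<tau> x l sequentially"
  using uo_Lebesgue_topologyD[OF assms(1) directed_index_nat assms(2-4)] by (simp add: net_filter_nat)

section \<open>The topology of the uo-continuous pseudonorms\<close>

text \<open>Continuity of scaling is demanded only along the scalars
  \<open>inverse (real (Suc n))\<close>; monotonicity extends it to all small scalars.\<close>

definition uo_pseudonorm :: "'a::archimedean_vector_lattice set \<Rightarrow> ('a \<Rightarrow> real) \<Rightarrow> bool" where
  "uo_pseudonorm X \<rho> \<longleftrightarrow>
     (\<forall>x\<in>X. 0 \<le> \<rho> x) \<and> (\<forall>x\<in>X. \<forall>y\<in>X. \<bar>x\<bar> \<le> \<bar>y\<bar> \<longrightarrow> \<rho> x \<le> \<rho> y) \<and>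
     (\<forall>x\<in>X. \<forall>y\<in>X. \<rho> (x + y) \<le> \<rho> x + \<rho> y) \<and>
     (\<forall>x\<in>X. \<forall>\<epsilon>>0. \<exists>n. \<rho> (inverse (real (Suc n)) *\<^sub>R x) < \<epsilon>) \<and>
     (\<forall>(A::'a net_index set) r x. \<forall>l\<in>X. \<forall>\<epsilon>>0. directed_index A r \<and> x ` A \<subseteq> X \<and> uo_conv X A r x l \<longrightarrow>
        eventually (\<lambda>a. \<rho> (x a - l) < \<epsilon>) (net_filter A r))"

text \<open>Admitting all such pseudonorms makes the uo-Lebesgue property automatic for every
  sublattice; only the Hausdorff property calls on \<open>F\<close>. A single pseudonorm per point
  suffices, as sums are pseudonorms again.\<close>

definition uo_topology :: "'a::archimedean_vector_lattice set \<Rightarrow> 'a topology" where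
  "uo_topology X = topology (\<lambda>W. W \<subseteq> X \<and>
     (\<forall>a\<in>W. \<exists>\<rho> \<epsilon>. uo_pseudonorm X \<rho> \<and> 0 < \<epsilon> \<and> (\<forall>y\<in>X. \<rho> (y - a) < \<epsilon> \<longrightarrow> y \<in> W)))"

lemma abs_scaleR_mono:
  fixes x :: "'a::archimedean_vector_lattice"
  assumes "\<bar>c\<bar> \<le> d"
  shows "\<bar>c *\<^sub>R x\<bar> \<le> \<bar>d *\<^sub>R x\<bar>"
proof -
  have le: "\<bar>c *\<^sub>R x\<bar> \<le> d *\<^sub>R \<bar>x\<bar>" if "\<bar>c\<bar> \<le> d" for c d and x :: 'a
  proof -
    have d: "\<bar>c\<bar> *\<^sub>R \<bar>x\<bar> \<le> d *\<^sub>R \<bar>x\<bar>" using that by (intro scaleR_right_mono) auto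
    have "\<bar>c\<bar> *\<^sub>R x \<le> \<bar>c\<bar> *\<^sub>R \<bar>x\<bar>" "\<bar>c\<bar> *\<^sub>R (- x) \<le> \<bar>c\<bar> *\<^sub>R \<bar>x\<bar>"
      by (intro scaleR_left_mono abs_ge_self abs_ge_minus_self; simp)+
    with d have "\<bar>c\<bar> *\<^sub>R x \<le> d *\<^sub>R \<bar>x\<bar>" "- (\<bar>c\<bar> *\<^sub>R x) \<le> d *\<^sub>R \<bar>x\<bar>"
      using order_trans by (metis, metis scaleR_minus_right)
    then show ?thesis by (cases "0 \<le> c") (auto intro: abs_leI)
  qed
  have "d *\<^sub>R \<bar>x\<bar> \<le> \<bar>d *\<^sub>R x\<bar>"
  proof (cases "d = 0")
    case False
    then have d: "0 < d" using assms by simp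
    \<comment> \<open>The estimate \<open>le\<close> read backwards, for the inverse scalar and the
      vector \<open>d *\<^sub>R x\<close>.\<close>
    then have "\<bar>x\<bar> \<le> inverse d *\<^sub>R \<bar>d *\<^sub>R x\<bar>" using le[of "inverse d" "inverse d" "d *\<^sub>R x"] by simp
    then have "d *\<^sub>R \<bar>x\<bar> \<le> d *\<^sub>R (inverse d *\<^sub>R \<bar>d *\<^sub>R x\<bar>)"
      using d by (intro scaleR_left_mono) auto
    then show ?thesis using d by simp
  qed simp
  with le[OF assms] show ?thesis by (rule order_trans)
qed

lemma down_to_0_scaled:
  assumes X: "vector_sublattice X" and v: "v \<in> X" "0 \<le> v"
  shows "down_to_0 X (range (\<lambda>n. inverse (real (Suc n)) *\<^sub>R v))"
  unfolding down_to_0_def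
proof (intro conjI ballI impI)
  let ?R = "range (\<lambda>n. inverse (real (Suc n)) *\<^sub>R v)"
  show "?R \<subseteq> X" using sublattice_scaleR[OF X v(1)] by blast
  show "?R \<noteq> {}" by blast
  show "0 \<le> d" if "d \<in> ?R" for d using that v(2) by (auto intro!: scaleR_nonneg_nonneg)
  show "\<exists>c\<in>?R. c \<le> a \<and> c \<le> b" if ab: "a \<in> ?R" "b \<in> ?R" for a b
  proof -
    obtain n m where "a = inverse (real (Suc n)) *\<^sub>R v" "b = inverse (real (Suc m)) *\<^sub>R v"
      using ab by blast
    then show ?thesis using v(2)
      by (intro bexI[of _ "inverse (real (Suc (max n m))) *\<^sub>R v"])
        (auto intro!: scaleR_right_mono le_imp_inverse_le)
  qed
  fix e assume e: "e \<in> X" "0 \<le> e" "\<forall>d\<in>?R. e \<le> d"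
  show "e = 0"
  proof (rule archimedean[OF e(2), of v])
    fix n :: nat
    show "real n *\<^sub>R e \<le> v"
    proof (cases n)
      case (Suc m)
      have "e \<le> inverse (real (Suc m)) *\<^sub>R v" using e(3) by blast
      then have "real (Suc m) *\<^sub>R e \<le> real (Suc m) *\<^sub>R inverse (real (Suc m)) *\<^sub>R v"
        by (rule scaleR_left_mono) simp
      then show ?thesis by (simp add: Suc)
    qed (simp add: v(2))
  qed
qed

context
  fixes X :: "'a::archimedean_vector_lattice set"
  assumes X: "vector_sublattice X"
begin

lemma uo_pseudonormD:
  assumes "uo_pseudonorm X \<rho>"
  shows "x \<in> X \<Longrightarrow> 0 \<le> \<rho> x"
    and "x \<in> X \<Longrightarrow> y \<in> X \<Longrightarrow> \<bar>x\<bar> \<le> \<bar>y\<bar> \<Longrightarrow> \<rho> x \<le> \<rho> y"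
    and "x \<in> X \<Longrightarrow> y \<in> X \<Longrightarrow> \<rho> (x + y) \<le> \<rho> x + \<rho> y"
    and "x \<in> X \<Longrightarrow> 0 < \<epsilon> \<Longrightarrow> \<exists>n. \<rho> (inverse (real (Suc n)) *\<^sub>R x) < \<epsilon>"
  using assms unfolding uo_pseudonorm_def by blast+

lemma uo_pseudonorm_zero:
  assumes "uo_pseudonorm X \<rho>"
  shows "\<rho> 0 = 0"
proof (rule antisym)
  show "\<rho> 0 \<le> 0"
  proof (rule field_le_epsilon)
    fix e :: real assume "0 < e"
    from uo_pseudonormD(4)[OF assms sublattice_zero[OF X] this] show "\<rho> 0 \<le> 0 + e" by auto
  qed
qed (rule uo_pseudonormD(1)[OF assms sublattice_zero[OF X]])

lemma uo_pseudonorm_triangle: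
  assumes "uo_pseudonorm X \<rho>" "x \<in> X" "y \<in> X" "z \<in> X"
  shows "\<rho> (x - z) \<le> \<rho> (x - y) + \<rho> (y - z)"
  using uo_pseudonormD(3)[OF assms(1), of "x - y" "y - z"] assms sublattice_diff[OF X] by simp

lemma uo_pseudonorm_scaleR_nat:
  assumes "uo_pseudonorm X \<rho>" "x \<in> X"
  shows "\<rho> (real n *\<^sub>R x) \<le> real n * \<rho> x"
proof (induction n)
  case (Suc n)
  have "\<rho> (real (Suc n) *\<^sub>R x) \<le> \<rho> (real n *\<^sub>R x) + \<rho> x"
    unfolding scaleR_Suc using assms sublattice_scaleR[OF X] by (intro uo_pseudonormD(3))
  with Suc show ?case by (simp add: algebra_simps)
qed (simp add: uo_pseudonorm_zero[OF assms(1)])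

lemma uo_pseudonorm_const_zero: "uo_pseudonorm X (\<lambda>_. 0)"
  by (simp add: uo_pseudonorm_def)

lemma uo_pseudonorm_add:
  assumes \<rho>: "uo_pseudonorm X \<rho>" and \<pi>: "uo_pseudonorm X \<pi>"
  shows "uo_pseudonorm X (\<lambda>x. \<rho> x + \<pi> x)"
  unfolding uo_pseudonorm_def
proof (intro conjI ballI impI allI)
  fix x assume x: "x \<in> X"
  show "0 \<le> \<rho> x + \<pi> x" using x uo_pseudonormD(1)[OF \<rho>] uo_pseudonormD(1)[OF \<pi>] by simp
  fix \<epsilon> :: real assume "0 < \<epsilon>"
  then obtain n m where nm: "\<rho> (inverse (real (Suc n)) *\<^sub>R x) < \<epsilon> / 2"
    "\<pi> (inverse (real (Suc m)) *\<^sub>R x) < \<epsilon> / 2"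
    using uo_pseudonormD(4)[OF \<rho> x, of "\<epsilon> / 2"] uo_pseudonormD(4)[OF \<pi> x, of "\<epsilon> / 2"] by auto
  let ?k = "max n m"
  have "\<bar>inverse (real (Suc ?k)) *\<^sub>R x\<bar> \<le> \<bar>inverse (real (Suc n)) *\<^sub>R x\<bar>"
    "\<bar>inverse (real (Suc ?k)) *\<^sub>R x\<bar> \<le> \<bar>inverse (real (Suc m)) *\<^sub>R x\<bar>"
    by (intro abs_scaleR_mono; simp add: le_imp_inverse_le)+
  then have "\<rho> (inverse (real (Suc ?k)) *\<^sub>R x) \<le> \<rho> (inverse (real (Suc n)) *\<^sub>R x)"
    "\<pi> (inverse (real (Suc ?k)) *\<^sub>R x) \<le> \<pi> (inverse (real (Suc m)) *\<^sub>R x)"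
    using x by (auto intro: uo_pseudonormD(2)[OF \<rho>] uo_pseudonormD(2)[OF \<pi>] sublattice_scaleR[OF X])
  with nm show "\<exists>n. \<rho> (inverse (real (Suc n)) *\<^sub>R x) + \<pi> (inverse (real (Suc n)) *\<^sub>R x) < \<epsilon>"
    by (intro exI[of _ ?k]) linarith
next
  fix x y assume "x \<in> X" "y \<in> X" "\<bar>x\<bar> \<le> \<bar>y\<bar>"
  then show "\<rho> x + \<pi> x \<le> \<rho> y + \<pi> y"
    using uo_pseudonormD(2)[OF \<rho>] uo_pseudonormD(2)[OF \<pi>] by (simp add: add_mono)
next
  fix x y assume "x \<in> X" "y \<in> X"
  then show "\<rho> (x + y) + \<pi> (x + y) \<le> \<rho> x + \<pi> x + (\<rho> y + \<pi> y)"
    using uo_pseudonormD(3)[OF \<rho>, of x y] uo_pseudonormD(3)[OF \<pi>, of x y] by simp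
next
  fix A :: "'a net_index set" and r x l and \<epsilon> :: real
  assume *: "l \<in> X" "0 < \<epsilon>" "directed_index A r \<and> x ` A \<subseteq> X \<and> uo_conv X A r x l"
  then have h: "0 < \<epsilon> / 2" by simp
  have "\<forall>\<^sub>F a in net_filter A r. \<rho> (x a - l) < \<epsilon> / 2"
    using \<rho> *(1,3) h unfolding uo_pseudonorm_def by blast
  moreover have "\<forall>\<^sub>F a in net_filter A r. \<pi> (x a - l) < \<epsilon> / 2"
    using \<pi> *(1,3) h unfolding uo_pseudonorm_def by blast
  ultimately show "\<forall>\<^sub>F a in net_filter A r. \<rho> (x a - l) + \<pi> (x a - l) < \<epsilon>"
    by eventually_elim simp
qed

lemma openin_uo_topology:
  "openin (uo_topology X) W \<longleftrightarrow> W \<subseteq> X \<and>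
     (\<forall>a\<in>W. \<exists>\<rho> \<epsilon>. uo_pseudonorm X \<rho> \<and> 0 < \<epsilon> \<and> (\<forall>y\<in>X. \<rho> (y - a) < \<epsilon> \<longrightarrow> y \<in> W))"
proof -
  let ?P = "\<lambda>W. W \<subseteq> X \<and>
     (\<forall>a\<in>W. \<exists>\<rho> \<epsilon>. uo_pseudonorm X \<rho> \<and> 0 < \<epsilon> \<and> (\<forall>y\<in>X. \<rho> (y - a) < \<epsilon> \<longrightarrow> y \<in> W))"
  have "istopology ?P"
    unfolding istopology_def
  proof (intro conjI allI impI)
    fix S T assume S: "?P S" and T: "?P T"
    show "S \<inter> T \<subseteq> X" using S by blast
    show "\<forall>a\<in>S \<inter> T. \<exists>\<rho> \<epsilon>. uo_pseudonorm X \<rho> \<and> 0 < \<epsilon> \<and> (\<forall>y\<in>X. \<rho> (y - a) < \<epsilon> \<longrightarrow> y \<in> S \<inter> T)"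
    proof
      fix a assume a: "a \<in> S \<inter> T"
      then obtain \<rho> \<epsilon> \<pi> \<delta> where *: "uo_pseudonorm X \<rho>" "0 < \<epsilon>" "\<forall>y\<in>X. \<rho> (y - a) < \<epsilon> \<longrightarrow> y \<in> S"
        "uo_pseudonorm X \<pi>" "0 < \<delta>" "\<forall>y\<in>X. \<pi> (y - a) < \<delta> \<longrightarrow> y \<in> T"
        using S T by (metis IntE)
      have "y \<in> S \<inter> T" if y: "y \<in> X" "\<rho> (y - a) + \<pi> (y - a) < min \<epsilon> \<delta>" for y
      proof -
        have "y - a \<in> X" using y a S sublattice_diff[OF X] by blast
        then have "0 \<le> \<rho> (y - a)" "0 \<le> \<pi> (y - a)" using uo_pseudonormD(1) * by auto
        then have "\<rho> (y - a) < \<epsilon>" "\<pi> (y - a) < \<delta>" using y by linarith+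
        then show ?thesis using * y by blast
      qed
      moreover have "0 < min \<epsilon> \<delta>" using * by simp
      ultimately show "\<exists>\<rho> \<epsilon>. uo_pseudonorm X \<rho> \<and> 0 < \<epsilon> \<and> (\<forall>y\<in>X. \<rho> (y - a) < \<epsilon> \<longrightarrow> y \<in> S \<inter> T)"
        using uo_pseudonorm_add[OF *(1,4)] by blast
    qed
  next
    fix \<K> assume K: "\<forall>K\<in>\<K>. ?P K"
    then show "\<Union>\<K> \<subseteq> X" by blast
    show "\<forall>a\<in>\<Union>\<K>. \<exists>\<rho> \<epsilon>. uo_pseudonorm X \<rho> \<and> 0 < \<epsilon> \<and> (\<forall>y\<in>X. \<rho> (y - a) < \<epsilon> \<longrightarrow> y \<in> \<Union>\<K>)"
    proof
      fix a assume "a \<in> \<Union>\<K>"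
      then obtain K where "K \<in> \<K>" "a \<in> K" by blast
      with K show "\<exists>\<rho> \<epsilon>. uo_pseudonorm X \<rho> \<and> 0 < \<epsilon> \<and> (\<forall>y\<in>X. \<rho> (y - a) < \<epsilon> \<longrightarrow> y \<in> \<Union>\<K>)"
        by (meson UnionI)
    qed
  qed
  from topology_inverse'[OF this] show ?thesis by (simp add: uo_topology_def)
qed

lemma topspace_uo_topology: "topspace (uo_topology X) = X"
proof
  have "openin (uo_topology X) X"
    unfolding openin_uo_topology using uo_pseudonorm_const_zero by (auto intro: exI[of _ 1])
  then show "X \<subseteq> topspace (uo_topology X)" by (rule openin_subset)
  show "topspace (uo_topology X) \<subseteq> X"
    using openin_topspace[of "uo_topology X"] unfolding openin_uo_topology by blast
qed

lemma openin_pseudoball: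
  assumes \<rho>: "uo_pseudonorm X \<rho>" and a: "a \<in> X"
  shows "openin (uo_topology X) {y \<in> X. \<rho> (y - a) < \<epsilon>}"
  unfolding openin_uo_topology
proof (intro conjI ballI)
  fix y assume y: "y \<in> {y \<in> X. \<rho> (y - a) < \<epsilon>}"
  have "z \<in> {y \<in> X. \<rho> (y - a) < \<epsilon>}" if "z \<in> X" "\<rho> (z - y) < \<epsilon> - \<rho> (y - a)" for z
    using uo_pseudonorm_triangle[OF \<rho>, of z y a] y a that by simp
  moreover have "0 < \<epsilon> - \<rho> (y - a)" using y by simp
  ultimately show "\<exists>\<rho>' \<epsilon>'. uo_pseudonorm X \<rho>' \<and> 0 < \<epsilon>' \<and>
      (\<forall>z\<in>X. \<rho>' (z - y) < \<epsilon>' \<longrightarrow> z \<in> {y \<in> X. \<rho> (y - a) < \<epsilon>})"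
    using \<rho> by blast
qed auto

lemma pseudoball_self:
  assumes "uo_pseudonorm X \<rho>" "a \<in> X" "0 < \<epsilon>"
  shows "a \<in> {y \<in> X. \<rho> (y - a) < \<epsilon>}"
  using assms by (simp add: uo_pseudonorm_zero[OF assms(1)])

lemma linear_topology_uo_topology: "linear_topology X (uo_topology X)"
  unfolding linear_topology_def continuous_map_def openin_prod_topology_alt
proof (intro conjI allI impI)
  note cl = sublattice_closed[OF X] and top = topspace_uo_topology
  show "topspace (uo_topology X) = X" by (rule top)
  show "(\<lambda>(x, y). x + y) \<in> topspace (prod_topology (uo_topology X) (uo_topology X)) \<rightarrow>
      topspace (uo_topology X)" using cl by (auto simp: top)
  show "(\<lambda>(c, x). c *\<^sub>R x) \<in> topspace (prod_topology euclideanreal (uo_topology X)) \<rightarrow>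
      topspace (uo_topology X)" using cl by (auto simp: top)
next
  note cl = sublattice_closed[OF X] and top = topspace_uo_topology
  fix W x y assume W: "openin (uo_topology X) W" and xy: "(x, y) \<in>
    {p \<in> topspace (prod_topology (uo_topology X) (uo_topology X)). (case p of (x, y) \<Rightarrow> x + y) \<in> W}"
  then have x: "x \<in> X" and y: "y \<in> X" and "x + y \<in> W" by (auto simp: top)
  then obtain \<rho> \<epsilon> where \<rho>: "uo_pseudonorm X \<rho>" and \<epsilon>: "0 < \<epsilon>" "\<forall>z\<in>X. \<rho> (z - (x + y)) < \<epsilon> \<longrightarrow> z \<in> W"
    using W unfolding openin_uo_topology by blast
  let ?B = "\<lambda>a. {z \<in> X. \<rho> (z - a) < \<epsilon> / 2}"
  have "x' + y' \<in> W" if "x' \<in> ?B x" "y' \<in> ?B y" for x' y'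
  proof -
    have "\<rho> ((x' - x) + (y' - y)) \<le> \<rho> (x' - x) + \<rho> (y' - y)"
      using that x y cl by (intro uo_pseudonormD(3)[OF \<rho>]) auto
    also have "\<dots> < \<epsilon>" using that by simp
    also have "(x' - x) + (y' - y) = x' + y' - (x + y)" by simp
    finally show ?thesis using \<epsilon>(2) that cl(2) by blast
  qed
  then have "?B x \<times> ?B y \<subseteq> {p \<in> topspace (prod_topology (uo_topology X) (uo_topology X)).
      (case p of (x, y) \<Rightarrow> x + y) \<in> W}" by (auto simp: top)
  then show "\<exists>U V. openin (uo_topology X) U \<and> openin (uo_topology X) V \<and> x \<in> U \<and> y \<in> V \<and>
      U \<times> V \<subseteq> {p \<in> topspace (prod_topology (uo_topology X) (uo_topology X)).
        (case p of (x, y) \<Rightarrow> x + y) \<in> W}"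
    using openin_pseudoball[OF \<rho>] pseudoball_self[OF \<rho>] x y \<epsilon>(1) half_gt_zero by meson
next
  note cl = sublattice_closed[OF X] and top = topspace_uo_topology
  fix W c x assume W: "openin (uo_topology X) W" and cx: "(c, x) \<in>
    {p \<in> topspace (prod_topology euclideanreal (uo_topology X)). (case p of (c, x) \<Rightarrow> c *\<^sub>R x) \<in> W}"
  then have x: "x \<in> X" and "c *\<^sub>R x \<in> W" by (auto simp: top)
  then obtain \<rho> \<epsilon> where \<rho>: "uo_pseudonorm X \<rho>" and \<epsilon>: "0 < \<epsilon>" "\<forall>z\<in>X. \<rho> (z - c *\<^sub>R x) < \<epsilon> \<longrightarrow> z \<in> W"
    using W unfolding openin_uo_topology by blast
  \<comment> \<open>The increment is split into \<open>c' *\<^sub>R (x' - x)\<close> and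
    \<open>(c' - c) *\<^sub>R x\<close>. Here \<open>m\<close> controls the second part;
    \<open>n\<close> bounds all \<open>c'\<close> near \<open>c\<close>, and subadditivity controls
    the first part at the cost of a factor \<open>n\<close>.\<close>
  obtain m where m: "\<rho> (inverse (real (Suc m)) *\<^sub>R x) < \<epsilon> / 2"
    using uo_pseudonormD(4)[OF \<rho> x, of "\<epsilon> / 2"] \<epsilon>(1) by auto
  obtain n :: nat where n: "\<bar>c\<bar> + 1 < real n" using reals_Archimedean2 by blast
  then have n0: "0 < real n" by linarith
  define C where "C = ball c (min 1 (inverse (real (Suc m))))"
  let ?B = "{z \<in> X. \<rho> (z - x) < \<epsilon> / (2 * real n)}"
  have "c' *\<^sub>R x' \<in> W" if "c' \<in> C" "x' \<in> ?B" for c' x'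
  proof -
    have c': "\<bar>c' - c\<bar> < 1" "\<bar>c' - c\<bar> < inverse (real (Suc m))"
      using that(1) by (auto simp: C_def dist_real_def abs_minus_commute)
    have X': "x' - x \<in> X" "x' \<in> X" using that x cl by auto
    have "\<rho> (c' *\<^sub>R (x' - x)) \<le> \<rho> (real n *\<^sub>R (x' - x))"
      using c' n X' cl by (intro uo_pseudonormD(2)[OF \<rho>] abs_scaleR_mono) auto
    also have "\<dots> \<le> real n * \<rho> (x' - x)" by (rule uo_pseudonorm_scaleR_nat[OF \<rho> X'(1)])
    also have "\<dots> < real n * (\<epsilon> / (2 * real n))"
      using that(2) n0 by (intro mult_strict_left_mono) auto
    also have "\<dots> = \<epsilon> / 2" using n0 by (simp add: field_simps)
    finally have 1: "\<rho> (c' *\<^sub>R (x' - x)) < \<epsilon> / 2" .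
    have "\<rho> ((c' - c) *\<^sub>R x) \<le> \<rho> (inverse (real (Suc m)) *\<^sub>R x)"
      using c' x cl by (intro uo_pseudonormD(2)[OF \<rho>] abs_scaleR_mono) auto
    with m have 2: "\<rho> ((c' - c) *\<^sub>R x) < \<epsilon> / 2" by simp
    have "\<rho> (c' *\<^sub>R (x' - x) + (c' - c) *\<^sub>R x) \<le> \<rho> (c' *\<^sub>R (x' - x)) + \<rho> ((c' - c) *\<^sub>R x)"
      using x X' cl by (intro uo_pseudonormD(3)[OF \<rho>]) auto
    also have "\<dots> < \<epsilon>" using 1 2 by simp
    also have "c' *\<^sub>R (x' - x) + (c' - c) *\<^sub>R x = c' *\<^sub>R x' - c *\<^sub>R x"
      by (simp add: algebra_simps)
    finally show ?thesis using \<epsilon>(2) cl(5)[OF X'(2)] by blast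
  qed
  then have "C \<times> ?B \<subseteq> {p \<in> topspace (prod_topology euclideanreal (uo_topology X)).
      (case p of (c, x) \<Rightarrow> c *\<^sub>R x) \<in> W}" by (auto simp: top)
  moreover have "openin euclideanreal C" "c \<in> C" by (simp_all add: C_def)
  moreover have "openin (uo_topology X) ?B" by (rule openin_pseudoball[OF \<rho> x])
  moreover have "x \<in> ?B" using \<epsilon>(1) n0 by (intro pseudoball_self[OF \<rho> x]) simp
  ultimately show "\<exists>U V. openin euclideanreal U \<and> openin (uo_topology X) V \<and> c \<in> U \<and> x \<in> V \<and>
      U \<times> V \<subseteq> {p \<in> topspace (prod_topology euclideanreal (uo_topology X)).
        (case p of (c, x) \<Rightarrow> c *\<^sub>R x) \<in> W}"
    by blast
qed

lemma uo_Lebesgue_uo_topology: "uo_Lebesgue_topology X (uo_topology X)"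
  unfolding uo_Lebesgue_topology_def locally_solid_topology_def
proof (intro conjI allI impI ballI)
  show "linear_topology X (uo_topology X)" by (rule linear_topology_uo_topology)
  show "neighbourhood_base_at 0 (solid_in X) (uo_topology X)"
    unfolding neighbourhood_base_at_def
  proof (intro allI impI)
    fix W assume W: "openin (uo_topology X) W \<and> 0 \<in> W"
    then obtain \<rho> \<epsilon> where \<rho>: "uo_pseudonorm X \<rho>" "0 < \<epsilon>" "\<forall>y\<in>X. \<rho> (y - 0) < \<epsilon> \<longrightarrow> y \<in> W"
      unfolding openin_uo_topology by blast
    let ?B = "{y \<in> X. \<rho> (y - 0) < \<epsilon>}"
    have "x \<in> ?B" if "x \<in> X" "v \<in> ?B" "\<bar>x\<bar> \<le> \<bar>v\<bar>" for x v
      using uo_pseudonormD(2)[OF \<rho>(1) that(1) _ that(3)] that by auto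
    then have "solid_in X ?B" unfolding solid_in_def by blast
    moreover have "?B \<subseteq> W" using \<rho>(3) by blast
    ultimately show "\<exists>U V. openin (uo_topology X) U \<and> solid_in X V \<and> 0 \<in> U \<and> U \<subseteq> V \<and> V \<subseteq> W"
      using openin_pseudoball[OF \<rho>(1) sublattice_zero[OF X]]
        pseudoball_self[OF \<rho>(1) sublattice_zero[OF X] \<rho>(2)] by blast
  qed
next
  fix A :: "'a net_index set" and r x l
  assume l: "l \<in> X" and *: "directed_index A r \<and> x ` A \<subseteq> X \<and> uo_conv X A r x l"
  show "limitin (uo_topology X) x l (net_filter A r)"
    unfolding limitin_def
  proof (intro conjI allI impI)
    show "l \<in> topspace (uo_topology X)" using l topspace_uo_topology by simp
    fix W assume "openin (uo_topology X) W \<and> l \<in> W"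
    then obtain \<rho> \<epsilon> where \<rho>: "uo_pseudonorm X \<rho>" "0 < \<epsilon>" "\<forall>y\<in>X. \<rho> (y - l) < \<epsilon> \<longrightarrow> y \<in> W"
      unfolding openin_uo_topology by blast
    have "\<forall>\<^sub>F a in net_filter A r. \<rho> (x a - l) < \<epsilon>"
      using \<rho>(1,2) * l unfolding uo_pseudonorm_def by blast
    moreover have "\<forall>\<^sub>F a in net_filter A r. x a \<in> X"
    proof -
      have "\<exists>a. a \<in> A" "directed_index A r" using * by (auto simp: directed_index_def)
      with * show ?thesis by (auto simp: eventually_net_filter)
    qed
    ultimately show "\<forall>\<^sub>F a in net_filter A r. x a \<in> W"
      by eventually_elim (use \<rho>(3) in blast)
  qed
qed

lemma Hausdorff_uo_topology:
  assumes sep: "\<And>x. x \<in> X \<Longrightarrow> x \<noteq> 0 \<Longrightarrow> \<exists>\<rho>. uo_pseudonorm X \<rho> \<and> 0 < \<rho> x"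
  shows "Hausdorff_space (uo_topology X)"
  unfolding Hausdorff_space_def
proof (intro allI impI)
  fix x y assume "x \<in> topspace (uo_topology X) \<and> y \<in> topspace (uo_topology X) \<and> x \<noteq> y"
  then have xy: "x \<in> X" "y \<in> X" "x \<noteq> y" by (simp_all add: topspace_uo_topology)
  then obtain \<rho> where \<rho>: "uo_pseudonorm X \<rho>" "0 < \<rho> (x - y)"
    using sep[of "x - y"] sublattice_diff[OF X] by auto
  let ?B = "\<lambda>a. {z \<in> X. \<rho> (z - a) < \<rho> (x - y) / 2}"
  have "False" if "z \<in> ?B x" "z \<in> ?B y" for z
  proof -
    have "\<rho> (x - z) \<le> \<rho> (z - x)"
      using that xy by (intro uo_pseudonormD(2)[OF \<rho>(1)])
        (auto simp: abs_minus_commute intro: sublattice_diff[OF X])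
    then show False using uo_pseudonorm_triangle[OF \<rho>(1), of x z y] that xy by simp
  qed
  then have "disjnt (?B x) (?B y)" by (auto simp: disjnt_def)
  moreover have "openin (uo_topology X) (?B x)" "openin (uo_topology X) (?B y)"
    by (rule openin_pseudoball[OF \<rho>(1)], rule xy)+
  moreover have "x \<in> ?B x" "y \<in> ?B y"
    using \<rho>(2) xy by (auto intro: pseudoball_self[OF \<rho>(1)] simp: uo_pseudonorm_zero[OF \<rho>(1)])
  ultimately show "\<exists>U V. openin (uo_topology X) U \<and> openin (uo_topology X) V \<and> x \<in> U \<and> y \<in> V \<and> disjnt U V"
    by blast
qed

end

section \<open>Pseudonorms from order continuous functionals\<close>

text \<open>The modulus of the functional at \<open>v\<close>, by the Riesz-Kantorovich formula. For
  \<open>v\<close> in the ideal \<open>F\<close>, all competing \<open>y\<close> are in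
  \<open>F\<close>.\<close>

definition total_variation :: "('a::archimedean_vector_lattice \<Rightarrow> real) \<Rightarrow> 'a \<Rightarrow> real" where
  "total_variation \<phi> v = (SUP y\<in>{y. \<bar>y\<bar> \<le> v}. \<bar>\<phi> y\<bar>)"

context
  fixes F :: "'a::archimedean_vector_lattice set" and \<phi> :: "'a \<Rightarrow> real"
  assumes F: "lattice_ideal F" and \<phi>: "\<phi> \<in> oc_dual F"
begin

private lemma FX: "vector_sublattice F"
  by (rule vector_sublattice_ideal[OF F])

lemma ideal_mem: "v \<in> F \<Longrightarrow> \<bar>y\<bar> \<le> v \<Longrightarrow> y \<in> F"
  using F unfolding lattice_ideal_def solid_in_def
  by (meson UNIV_I abs_ge_self order_trans)

lemma oc_dual_add: "x \<in> F \<Longrightarrow> y \<in> F \<Longrightarrow> \<phi> (x + y) = \<phi> x + \<phi> y"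
  and oc_dual_scaleR: "x \<in> F \<Longrightarrow> \<phi> (c *\<^sub>R x) = c * \<phi> x"
  using \<phi> unfolding oc_dual_def by blast+

lemma oc_dual_uminus: "x \<in> F \<Longrightarrow> \<phi> (- x) = - \<phi> x"
  using oc_dual_scaleR[of x "-1"] by simp

text \<open>Order continuity along the net of all \<open>y\<close> indexed by the pairs \<open>(d, y)\<close> with \<open>\<bar>y\<bar> \<le> d\<close>
  gives uniform smallness on order intervals.\<close>

lemma oc_dual_uniform:
  assumes D: "down_to_0 F D" and \<epsilon>: "0 < \<epsilon>"
  obtains d where "d \<in> D" "\<And>y. \<bar>y\<bar> \<le> d \<Longrightarrow> \<bar>\<phi> y\<bar> < \<epsilon>"
proof -
  define A where "A = {(d, y). d \<in> D \<and> \<bar>y\<bar> \<le> d}"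
  define r where "r = {(p, q). p \<in> A \<and> q \<in> A \<and> fst q \<le> (fst p :: 'a)}"
  have D0: "(d, 0) \<in> A" if "d \<in> D" for d using that D by (auto simp: A_def down_to_0_def)
  have dir: "directed_index A r"
    unfolding directed_index_def
  proof (intro conjI ballI)
    show "A \<noteq> {}" using D0 D by (auto simp: down_to_0_def)
    show "preorder_on A r" by (auto simp: preorder_on_def refl_on_def trans_def r_def)
    fix p q assume pq: "p \<in> A" "q \<in> A"
    then have "fst p \<in> D" "fst q \<in> D" by (auto simp: A_def)
    then obtain c where "c \<in> D" "c \<le> fst p" "c \<le> fst q" using D unfolding down_to_0_def by blast
    then show "\<exists>c\<in>A. (p, c) \<in> r \<and> (q, c) \<in> r"
      using D0 pq by (intro bexI[of _ "(c, 0)"]) (auto simp: r_def)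
  qed
  have "\<exists>a0\<in>A. \<forall>a\<in>A. (a0, a) \<in> r \<longrightarrow> \<bar>0 - snd a\<bar> \<le> d" if "d \<in> D" for d
    using D0[OF that] by (intro bexI[of _ "(d, 0)"]) (auto simp: r_def A_def)
  then have conv: "order_conv F A r snd 0"
    using D unfolding order_conv_iff_set[OF FX] by blast
  have "snd ` A \<subseteq> F" using D ideal_mem by (auto simp: A_def down_to_0_def)
  from oc_dualD[OF \<phi> dir this conv] have "\<forall>\<^sub>F a in net_filter A r. \<bar>\<phi> (snd a)\<bar> < \<epsilon>"
    using \<epsilon> by (simp add: tendsto_iff)
  then obtain p where p: "p \<in> A" "\<forall>b\<in>A. (p, b) \<in> r \<longrightarrow> \<bar>\<phi> (snd b)\<bar> < \<epsilon>"
    unfolding eventually_net_filter[OF dir] by blast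
  show thesis
  proof (rule that)
    show d: "fst p \<in> D" using p by (auto simp: A_def)
    show "\<bar>\<phi> y\<bar> < \<epsilon>" if "\<bar>y\<bar> \<le> fst p" for y
      using p(2)[rule_format, of "(fst p, y)"] p(1) that d by (auto simp: r_def A_def)
  qed
qed

text \<open>Order continuity implies order boundedness: the uniform bound 1 below a small multiple
  of \<open>v\<close> scales up to a bound below \<open>v\<close>.\<close>

lemma total_variation_bdd:
  assumes "v \<in> F" "0 \<le> v"
  shows "bdd_above ((\<lambda>y. \<bar>\<phi> y\<bar>) ` {y. \<bar>y\<bar> \<le> v})"
proof -
  obtain d where d: "d \<in> range (\<lambda>n. inverse (real (Suc n)) *\<^sub>R v)" "\<And>y. \<bar>y\<bar> \<le> d \<Longrightarrow> \<bar>\<phi> y\<bar> < 1"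
    by (rule oc_dual_uniform[OF down_to_0_scaled[OF FX assms] zero_less_one], rule that)
  then obtain n where n: "d = inverse (real (Suc n)) *\<^sub>R v" by blast
  have "\<bar>\<phi> y\<bar> \<le> real (Suc n)" if y: "\<bar>y\<bar> \<le> v" for y
  proof -
    have "\<bar>inverse (real (Suc n)) *\<^sub>R y\<bar> \<le> d"
    proof -
      have *: "inverse (real (Suc n)) *\<^sub>R z \<le> d" if "z \<le> v" for z
        unfolding n using that by (intro scaleR_left_mono) auto
      have "y \<le> v" "- y \<le> v" using y by (auto simp: abs_le_iff)
      then show ?thesis using *[of y] *[of "- y"] by (auto intro: abs_leI)
    qed
    from d(2)[OF this] show ?thesis
      using oc_dual_scaleR[OF ideal_mem[OF assms(1) y]] by (simp add: abs_mult field_simps)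
  qed
  then show ?thesis by (intro bdd_aboveI2) auto
qed

lemma total_variation_ge: "v \<in> F \<Longrightarrow> \<bar>y\<bar> \<le> v \<Longrightarrow> \<bar>\<phi> y\<bar> \<le> total_variation \<phi> v"
  unfolding total_variation_def
  by (rule cSUP_upper[OF _ total_variation_bdd]) (auto intro: order_trans[OF abs_ge_zero])

lemma total_variation_le:
  "0 \<le> v \<Longrightarrow> (\<And>y. \<bar>y\<bar> \<le> v \<Longrightarrow> \<bar>\<phi> y\<bar> \<le> M) \<Longrightarrow> total_variation \<phi> v \<le> M"
  unfolding total_variation_def by (rule cSUP_least) (auto intro: exI[of _ 0])

lemma total_variation_mono: "a \<in> F \<Longrightarrow> b \<in> F \<Longrightarrow> 0 \<le> a \<Longrightarrow> a \<le> b \<Longrightarrow> total_variation \<phi> a \<le> total_variation \<phi> b"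
  by (intro total_variation_le total_variation_ge) auto

lemma total_variation_nonneg: "v \<in> F \<Longrightarrow> 0 \<le> v \<Longrightarrow> 0 \<le> total_variation \<phi> v"
  using total_variation_ge[of v 0] by force

text \<open>Riesz decomposition of \<open>y\<close> gives one inequality. For the other,
  \<open>y1\<close> and \<open>y2\<close> are replaced by their negatives where needed, so that the
  two values of \<phi> are nonnegative and do not cancel.\<close>

lemma total_variation_add:
  assumes a: "a \<in> F" "0 \<le> a" and b: "b \<in> F" "0 \<le> b"
  shows "total_variation \<phi> (a + b) = total_variation \<phi> a + total_variation \<phi> b"
proof (rule antisym)
  have ab: "a + b \<in> F" "0 \<le> a + b" using a b sublattice_add[OF FX] by auto
  show "total_variation \<phi> (a + b) \<le> total_variation \<phi> a + total_variation \<phi> b"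
  proof (rule total_variation_le[OF ab(2)])
    fix y assume "\<bar>y\<bar> \<le> a + b"
    from abs_le_add_decompose[OF a(2) b(2) this]
    obtain y1 y2 where y: "y = y1 + y2" "\<bar>y1\<bar> \<le> a" "\<bar>y2\<bar> \<le> b" .
    then have "\<phi> y = \<phi> y1 + \<phi> y2" using oc_dual_add ideal_mem a b by auto
    then show "\<bar>\<phi> y\<bar> \<le> total_variation \<phi> a + total_variation \<phi> b"
      using total_variation_ge[OF a(1) y(2)] total_variation_ge[OF b(1) y(3)] by linarith
  qed
  have "\<bar>\<phi> y1\<bar> + \<bar>\<phi> y2\<bar> \<le> total_variation \<phi> (a + b)" if y: "\<bar>y1\<bar> \<le> a" "\<bar>y2\<bar> \<le> b" for y1 y2
  proof -
    have sgn: "\<exists>z. \<bar>z\<bar> \<le> v \<and> \<phi> z = \<bar>\<phi> y\<bar>" if "v \<in> F" "\<bar>y\<bar> \<le> v" for y v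
      using that oc_dual_uminus[OF ideal_mem[OF that]]
      by (cases "0 \<le> \<phi> y") (auto intro: exI[of _ y] exI[of _ "- y"])
    obtain z1 z2 where z: "\<bar>z1\<bar> \<le> a" "\<phi> z1 = \<bar>\<phi> y1\<bar>" "\<bar>z2\<bar> \<le> b" "\<phi> z2 = \<bar>\<phi> y2\<bar>"
      using sgn[OF a(1) y(1)] sgn[OF b(1) y(2)] by blast
    have "\<bar>z1 + z2\<bar> \<le> a + b" by (rule order_trans[OF abs_triangle_ineq add_mono[OF z(1,3)]])
    from total_variation_ge[OF ab(1) this] show ?thesis
      using oc_dual_add[of z1 z2] z ideal_mem a b by auto
  qed
  then have "\<bar>\<phi> y1\<bar> \<le> total_variation \<phi> (a + b) - total_variation \<phi> b" if "\<bar>y1\<bar> \<le> a" for y1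
    using that total_variation_le[OF b(2), of "total_variation \<phi> (a + b) - \<bar>\<phi> y1\<bar>"] by fastforce
  from total_variation_le[OF a(2) this]
  show "total_variation \<phi> a + total_variation \<phi> b \<le> total_variation \<phi> (a + b)" by simp
qed

text \<open>Truncating by \<open>u\<close> moves \<open>D\<close> into the ideal \<open>F\<close>.
  The infimum remains 0, because a lower bound of the truncations is a lower bound of
  \<open>D\<close>.\<close>

lemma total_variation_down:
  assumes D: "down_to_0 UNIV D" and u: "u \<in> F" "0 \<le> u" and \<epsilon>: "0 < \<epsilon>"
  obtains d where "d \<in> D" "total_variation \<phi> (inf d u) \<le> \<epsilon>"
proof -
  have inF: "inf d u \<in> F" if "0 \<le> d" for d
    using ideal_mem[OF u(1), of "inf d u"] that u by simp
  have "down_to_0 F ((\<lambda>d. inf d u) ` D)"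
    unfolding down_to_0_def
  proof (intro conjI ballI impI)
    show "(\<lambda>d. inf d u) ` D \<subseteq> F" "(\<lambda>d. inf d u) ` D \<noteq> {}"
      using D inF by (auto simp: down_to_0_def)
    show "\<And>d. d \<in> (\<lambda>d. inf d u) ` D \<Longrightarrow> 0 \<le> d" using D u by (auto simp: down_to_0_def)
    show "\<exists>c\<in>(\<lambda>d. inf d u) ` D. c \<le> p \<and> c \<le> q"
      if pq: "p \<in> (\<lambda>d. inf d u) ` D" "q \<in> (\<lambda>d. inf d u) ` D" for p q
    proof -
      obtain a b where ab: "a \<in> D" "b \<in> D" "p = inf a u" "q = inf b u" using pq by blast
      then obtain c where "c \<in> D" "c \<le> a" "c \<le> b" using D unfolding down_to_0_def by blast
      then show ?thesis using ab by (intro bexI[of _ "inf c u"]) (auto intro: le_infI1)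
    qed
    show "e = 0" if "e \<in> F" "0 \<le> e" "\<forall>d\<in>(\<lambda>d. inf d u) ` D. e \<le> d" for e
      using D that by (auto simp: down_to_0_def)
  qed
  from oc_dual_uniform[OF this \<epsilon>]
  obtain d where d: "d \<in> D" "\<And>y. \<bar>y\<bar> \<le> inf d u \<Longrightarrow> \<bar>\<phi> y\<bar> < \<epsilon>" by blast
  have "0 \<le> inf d u" using d(1) D u by (auto simp: down_to_0_def)
  from total_variation_le[OF this less_imp_le[OF d(2)]] d(1) show thesis by (intro that)
qed

text \<open>Up to \<open>\<epsilon>\<close>, truncation at \<open>u\<close> is controlled by truncation at an element of \<open>X\<close>: take \<open>y\<close> in
  \<open>X\<close> for which the variation of \<open>inf y u\<close> is nearly maximal.\<close>

lemma total_variation_truncate: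
  assumes X: "vector_sublattice X" and u: "u \<in> F" "0 \<le> u" and \<epsilon>: "0 < \<epsilon>"
  obtains y where "y \<in> X" "0 \<le> y"
    "\<And>z. z \<in> X \<Longrightarrow> 0 \<le> z \<Longrightarrow> total_variation \<phi> (inf z u) \<le> total_variation \<phi> (inf (inf z y) u) + \<epsilon>"
proof -
  let ?P = "total_variation \<phi>"
  define Q where "Q = {y \<in> X. 0 \<le> y}"
  have inF: "inf d u \<in> F" if "0 \<le> d" for d
    using ideal_mem[OF u(1), of "inf d u"] that u by simp
  define s where "s = (SUP y\<in>Q. ?P (inf y u))"
  have bdd: "bdd_above ((\<lambda>y. ?P (inf y u)) ` Q)"
    using inF u by (intro bdd_aboveI2[of _ _ "?P u"] total_variation_mono) (auto simp: Q_def)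
  have "0 \<in> Q" using sublattice_zero[OF X] by (simp add: Q_def)
  then have "\<exists>y\<in>Q. s - \<epsilon> < ?P (inf y u)"
    using \<epsilon> less_cSUP_iff[OF _ bdd, of "s - \<epsilon>"] unfolding s_def by force
  then obtain y where y: "y \<in> Q" "s - \<epsilon> < ?P (inf y u)" by blast
  show thesis
  proof (rule that)
    show "y \<in> X" "0 \<le> y" using y by (auto simp: Q_def)
    fix z assume z: "z \<in> X" "0 \<le> z"
    let ?a = "inf z u" and ?b = "inf y u"
    have nn: "0 \<le> ?a" "0 \<le> ?b" using z u \<open>0 \<le> y\<close> by simp_all
    have aF: "?a \<in> F" "?b \<in> F" using inF z \<open>0 \<le> y\<close> by auto
    have yz: "sup z y \<in> Q" using z y sublattice_sup[OF X] by (auto simp: Q_def le_supI1)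
    have "sup ?a ?b \<le> inf (sup z y) u" by (simp add: le_infI1 le_supI1 le_supI2)
    moreover have "inf (sup z y) u \<in> F" using inF yz by (simp add: Q_def)
    ultimately have "?P (sup ?a ?b) \<le> ?P (inf (sup z y) u)"
      using nn aF sublattice_sup[OF FX] by (intro total_variation_mono) (auto intro: le_supI1)
    also have "\<dots> \<le> s" unfolding s_def by (rule cSUP_upper[OF yz bdd])
    finally have "?P (sup ?a ?b) \<le> s" .
    \<comment> \<open>Modularity is what exploits the near-maximality of \<open>y\<close>: the term
      for \<open>sup\<close> exceeds that for \<open>?b\<close> by less than \<epsilon>.\<close>
    moreover have "?P ?a + ?P ?b = ?P (sup ?a ?b) + ?P (inf ?a ?b)"
    proof -
      have "?P ?a + ?P ?b = ?P (?a + ?b)" using nn aF by (simp add: total_variation_add)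
      also have "\<dots> = ?P (sup ?a ?b + inf ?a ?b)" by (subst add_eq_inf_sup) (rule refl)
      also have "\<dots> = ?P (sup ?a ?b) + ?P (inf ?a ?b)"
        using nn aF sublattice_sup[OF FX] sublattice_inf[OF FX]
        by (intro total_variation_add) (auto intro: le_supI1)
      finally show ?thesis .
    qed
    moreover have "inf ?a ?b = inf (inf z y) u" by (simp add: inf_aci)
    ultimately show "?P ?a \<le> ?P (inf (inf z y) u) + \<epsilon>" using y(2) by simp
  qed
qed

text \<open>The obstacle is that uo-convergence in \<open>G\<close> tests truncations only by
  elements of \<open>G\<close>, while \<open>u\<close> lies in \<open>F\<close>.
  \<open>total_variation_truncate\<close> trades \<open>u\<close> for some \<open>y\<close> in
  \<open>G\<close>, and \<open>total_variation_down\<close> treats the remaining order null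
  net.\<close>

lemma uo_pseudonorm_total_variation:
  assumes G: "regular_sublattice G" and u: "u \<in> F" "0 \<le> u"
  shows "uo_pseudonorm G (\<lambda>x. total_variation \<phi> (inf \<bar>x\<bar> u))"
  unfolding uo_pseudonorm_def
proof (intro conjI ballI impI allI)
  let ?P = "total_variation \<phi>"
  have X: "vector_sublattice G" using G by (simp add: regular_sublattice_def)
  note cl = sublattice_closed[OF X]
  have inF: "inf d u \<in> F" if "0 \<le> d" for d
    using ideal_mem[OF u(1), of "inf d u"] that u by simp
  fix x assume x: "x \<in> G"
  show "0 \<le> ?P (inf \<bar>x\<bar> u)" using inF u by (intro total_variation_nonneg) auto
  show "?P (inf \<bar>x\<bar> u) \<le> ?P (inf \<bar>y\<bar> u)" if "\<bar>x\<bar> \<le> \<bar>y\<bar>" for y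
    using inF u that by (intro total_variation_mono) (auto intro: le_infI1)
  show "?P (inf \<bar>x + y\<bar> u) \<le> ?P (inf \<bar>x\<bar> u) + ?P (inf \<bar>y\<bar> u)" for y
  proof -
    have "inf \<bar>x + y\<bar> u \<le> inf (\<bar>x\<bar> + \<bar>y\<bar>) u" by (intro inf_mono abs_triangle_ineq order_refl)
    also have "\<dots> \<le> inf \<bar>x\<bar> u + inf \<bar>y\<bar> u" using u by (intro inf_add_le_add_inf) auto
    finally have "?P (inf \<bar>x + y\<bar> u) \<le> ?P (inf \<bar>x\<bar> u + inf \<bar>y\<bar> u)"
      using inF u sublattice_add[OF FX] by (intro total_variation_mono) auto
    then show ?thesis using inF u by (simp add: total_variation_add)
  qed
  fix \<epsilon> :: real assume \<epsilon>: "0 < \<epsilon>"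
  have "down_to_0 UNIV (range (\<lambda>n. inverse (real (Suc n)) *\<^sub>R \<bar>x\<bar>))"
    using regular_down_to_0[OF G down_to_0_scaled[OF X cl(8)[OF x] abs_ge_zero]] .
  then obtain d where "d \<in> range (\<lambda>n. inverse (real (Suc n)) *\<^sub>R \<bar>x\<bar>)" "?P (inf d u) \<le> \<epsilon> / 2"
    using \<epsilon> by (elim total_variation_down[OF _ u, of _ "\<epsilon> / 2"]) auto
  then obtain n where n: "?P (inf (inverse (real (Suc n)) *\<^sub>R \<bar>x\<bar>) u) \<le> \<epsilon> / 2" by blast
  have "\<bar>inverse (real (Suc n)) *\<^sub>R x\<bar> \<le> inverse (real (Suc n)) *\<^sub>R \<bar>x\<bar>"
  proof (rule abs_leI)
    have *: "inverse (real (Suc n)) *\<^sub>R z \<le> inverse (real (Suc n)) *\<^sub>R \<bar>x\<bar>" if "z \<le> \<bar>x\<bar>" for z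
      using that by (intro scaleR_left_mono) auto
    show "inverse (real (Suc n)) *\<^sub>R x \<le> inverse (real (Suc n)) *\<^sub>R \<bar>x\<bar>"
      "- (inverse (real (Suc n)) *\<^sub>R x) \<le> inverse (real (Suc n)) *\<^sub>R \<bar>x\<bar>"
      using *[OF abs_ge_self] *[OF abs_ge_minus_self] by simp_all
  qed
  then have "?P (inf \<bar>inverse (real (Suc n)) *\<^sub>R x\<bar> u) \<le> ?P (inf (inverse (real (Suc n)) *\<^sub>R \<bar>x\<bar>) u)"
    using inF u
    by (intro total_variation_mono) (auto intro: le_infI1 simp: scaleR_nonneg_nonneg)
  with n \<epsilon> show "\<exists>n. ?P (inf \<bar>inverse (real (Suc n)) *\<^sub>R x\<bar> u) < \<epsilon>" by (intro exI[of _ n]) linarith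
next
  let ?P = "total_variation \<phi>"
  have X: "vector_sublattice G" using G by (simp add: regular_sublattice_def)
  note cl = sublattice_closed[OF X]
  have inF: "inf d u \<in> F" if "0 \<le> d" for d
    using ideal_mem[OF u(1), of "inf d u"] that u by simp
  fix A :: "'a net_index set" and r x l and \<epsilon> :: real
  assume l: "l \<in> G" and \<epsilon>: "0 < \<epsilon>" and *: "directed_index A r \<and> x ` A \<subseteq> G \<and> uo_conv G A r x l"
  \<comment> \<open>Only two error terms occur; both bounds are weak, and the third share makes the
    final inequality strict.\<close>
  have \<epsilon>3: "0 < \<epsilon> / 3" using \<epsilon> by simp
  obtain y where y: "y \<in> G" "0 \<le> y"
    "\<And>z. z \<in> G \<Longrightarrow> 0 \<le> z \<Longrightarrow> ?P (inf z u) \<le> ?P (inf (inf z y) u) + \<epsilon> / 3"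
    by (rule total_variation_truncate[OF X u \<epsilon>3], rule that)
  have "order_conv G A r (\<lambda>a. inf \<bar>x a - l\<bar> y) 0" using * y unfolding uo_conv_def by blast
  then obtain D where D: "down_to_0 G D"
    "\<And>d. d \<in> D \<Longrightarrow> \<exists>a0\<in>A. \<forall>a\<in>A. (a0, a) \<in> r \<longrightarrow> \<bar>0 - (inf \<bar>x a - l\<bar> y)\<bar> \<le> d"
    unfolding order_conv_iff_set[OF X] by blast
  obtain d where d: "d \<in> D" "?P (inf d u) \<le> \<epsilon> / 3"
    by (rule total_variation_down[OF regular_down_to_0[OF G D(1)] u \<epsilon>3], rule that)
  have d0: "0 \<le> d" using d(1) D(1) by (simp add: down_to_0_def)
  obtain a0 where a0: "a0 \<in> A" "\<forall>a\<in>A. (a0, a) \<in> r \<longrightarrow> \<bar>0 - (inf \<bar>x a - l\<bar> y)\<bar> \<le> d"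
    using D(2)[OF d(1)] by blast
  have "?P (inf \<bar>x a - l\<bar> u) < \<epsilon>" if a: "a \<in> A" "(a0, a) \<in> r" for a
  proof -
    have "x a - l \<in> G" using * a l cl(3) by blast
    then have "?P (inf \<bar>x a - l\<bar> u) \<le> ?P (inf (inf \<bar>x a - l\<bar> y) u) + \<epsilon> / 3"
      using y(3) cl(8) by simp
    moreover have "0 \<le> inf \<bar>x a - l\<bar> y" using y by simp
    moreover have "inf \<bar>x a - l\<bar> y \<le> d"
    proof -
      have "\<bar>0 - (inf \<bar>x a - l\<bar> y)\<bar> = inf \<bar>x a - l\<bar> y"
        using \<open>0 \<le> inf \<bar>x a - l\<bar> y\<close> by (simp only: diff_0 abs_minus_cancel abs_of_nonneg)
      then show ?thesis using a0(2) a by metis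
    qed
    then have "?P (inf (inf \<bar>x a - l\<bar> y) u) \<le> ?P (inf d u)"
      using inF[OF d0] inF[OF \<open>0 \<le> inf \<bar>x a - l\<bar> y\<close>] inf_greatest[OF \<open>0 \<le> inf \<bar>x a - l\<bar> y\<close> u(2)]
      by (intro total_variation_mono inf_mono order_refl)
    ultimately show ?thesis using d(2) \<epsilon> by linarith
  qed
  then show "\<forall>\<^sub>F a in net_filter A r. ?P (inf \<bar>x a - l\<bar> u) < \<epsilon>"
    unfolding eventually_net_filter[OF conjunct1[OF *]] using a0(1) by blast
qed

end

theorem corollary8p5:
  fixes F G :: "'a::archimedean_vector_lattice set"
  assumes "countable_sup_property (UNIV :: 'a set)"
    and "lattice_ideal F" and "order_dense F"
    and "separates_points (oc_dual F) F"
    and "regular_sublattice G"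
  shows "\<exists>\<tau>G. uo_Lebesgue_topology G \<tau>G \<and> Hausdorff_space \<tau>G \<and>
    (\<forall>\<sigma>. uo_Lebesgue_topology G \<sigma> \<and> Hausdorff_space \<sigma> \<longrightarrow> \<sigma> = \<tau>G) \<and>
    ((\<exists>\<tau>. topspace \<tau> = G \<and>
        (\<forall>x l. range x \<subseteq> G \<and> l \<in> G \<longrightarrow>
           (uo_conv G UNIV nat_order x l \<longleftrightarrow> limitin \<tau> x l sequentially)))
      \<longleftrightarrow>
     (\<forall>x l. range x \<subseteq> G \<and> l \<in> G \<longrightarrow>
        (limitin \<tau>G x l sequentially \<longrightarrow> uo_conv G UNIV nat_order x l))) \<and>
    ((\<exists>\<tau>. topspace \<tau> = G \<and>
        (\<forall>x l. range x \<subseteq> G \<and> l \<in> G \<longrightarrow>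
           (uo_conv G UNIV nat_order x l \<longleftrightarrow> limitin \<tau> x l sequentially)))
      \<longrightarrow>
     (\<forall>x l. range x \<subseteq> G \<and> l \<in> G \<longrightarrow>
        (uo_conv G UNIV nat_order x l \<longleftrightarrow> limitin \<tau>G x l sequentially)))"
proof -
  note csp = assms(1) and F = assms(2) and dense = assms(3) and sep = assms(4) and G = assms(5)
  have X: "vector_sublattice G" using G by (simp add: regular_sublattice_def)
  let ?\<tau> = "uo_topology G"
  have uoL: "uo_Lebesgue_topology G ?\<tau>" by (rule uo_Lebesgue_uo_topology[OF X])
  have Haus: "Hausdorff_space ?\<tau>"
  proof (rule Hausdorff_uo_topology[OF X])
    fix x assume x: "x \<in> G" "x \<noteq> 0"
    then have "0 < \<bar>x\<bar>" by simp
    \<comment> \<open>Since \<open>u\<close> is below the modulus of \<open>x\<close>, truncating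
      that modulus at \<open>u\<close> returns \<open>u\<close>. A functional not vanishing at
      \<open>u\<close> therefore gives a pseudonorm that is positive at \<open>x\<close>.\<close>
    then obtain u where u: "u \<in> F" "0 < u" "u \<le> \<bar>x\<bar>" using dense unfolding order_dense_def by blast
    have "0 \<in> F" using sublattice_zero[OF vector_sublattice_ideal[OF F]] .
    moreover have "u \<noteq> 0" using u(2) by auto
    ultimately obtain \<phi> where \<phi>: "\<phi> \<in> oc_dual F" "\<phi> u \<noteq> \<phi> 0"
      using sep[unfolded separates_points_def, rule_format, OF u(1)] by blast
    have "\<phi> 0 = 0" using oc_dual_scaleR[OF F \<phi>(1) u(1), of 0] by simp
    then have "0 < \<bar>\<phi> u\<bar>" using \<phi>(2) by simp
    also have "\<dots> \<le> total_variation \<phi> u" using total_variation_ge[OF F \<phi>(1) u(1), of u] u(2) by simp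
    also have "u = inf \<bar>x\<bar> u" using u(3) by (simp add: inf_absorb2)
    finally show "\<exists>\<rho>. uo_pseudonorm G \<rho> \<and> 0 < \<rho> x"
      using uo_pseudonorm_total_variation[OF F \<phi>(1) G u(1)] u(2) by (auto intro!: exI)
  qed
  have unique: "\<sigma> = ?\<tau>" if \<sigma>: "uo_Lebesgue_topology G \<sigma>" "Hausdorff_space \<sigma>" for \<sigma>
  proof (rule linear_topology_eqI[OF X])
    show "linear_topology G \<sigma>" "linear_topology G ?\<tau>"
      using \<sigma> uoL by (auto simp: uo_Lebesgue_topology_def locally_solid_topology_def)
    show "zero_nbhd \<sigma> V \<longleftrightarrow> zero_nbhd ?\<tau> V" for V
      using uo_Lebesgue_topology_minimal[OF csp G \<sigma> uoL]
        uo_Lebesgue_topology_minimal[OF csp G uoL Haus \<sigma>(1)] by blast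
  qed
  have top: "topspace ?\<tau> = G" by (rule topspace_uo_topology[OF X])
  have uo_lim: "limitin ?\<tau> x l sequentially"
    if "range x \<subseteq> G" "l \<in> G" "uo_conv G UNIV nat_order x l" for x l
    by (rule uo_Lebesgue_limitin_sequentially[OF uoL that])
  let ?topological = "\<exists>\<tau>. topspace \<tau> = G \<and> (\<forall>x l. range x \<subseteq> G \<and> l \<in> G \<longrightarrow>
    (uo_conv G UNIV nat_order x l \<longleftrightarrow> limitin \<tau> x l sequentially))"
  have lim_uo: "uo_conv G UNIV nat_order x l"
    if S: ?topological and x: "range x \<subseteq> G" "l \<in> G" "limitin ?\<tau> x l sequentially" for x l
  proof -
    from S obtain T where "topspace T = G" "\<forall>x l. range x \<subseteq> G \<and> l \<in> G \<longrightarrow>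
        (uo_conv G UNIV nat_order x l \<longleftrightarrow> limitin T x l sequentially)"
      by blast
    then show ?thesis by (intro uo_conv_of_topological[OF csp G uoL Haus _ _ x]) simp_all
  qed
  have equiv: "?topological \<longleftrightarrow> (\<forall>x l. range x \<subseteq> G \<and> l \<in> G \<longrightarrow>
        (limitin ?\<tau> x l sequentially \<longrightarrow> uo_conv G UNIV nat_order x l))"
  proof (intro iffI)
    show "\<forall>x l. range x \<subseteq> G \<and> l \<in> G \<longrightarrow>
        (limitin ?\<tau> x l sequentially \<longrightarrow> uo_conv G UNIV nat_order x l)" if ?topological
      using lim_uo[OF that] by simp
    assume R: "\<forall>x l. range x \<subseteq> G \<and> l \<in> G \<longrightarrow>
        (limitin ?\<tau> x l sequentially \<longrightarrow> uo_conv G UNIV nat_order x l)"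
    show ?topological
      by (intro exI[of _ ?\<tau>] conjI top allI impI iffI) (simp_all add: R uo_lim)
  qed
  have sequential: "?topological \<longrightarrow> (\<forall>x l. range x \<subseteq> G \<and> l \<in> G \<longrightarrow>
        (uo_conv G UNIV nat_order x l \<longleftrightarrow> limitin ?\<tau> x l sequentially))"
  proof (intro impI allI iffI)
    fix x :: "nat \<Rightarrow> 'a" and l assume S: ?topological and "range x \<subseteq> G \<and> l \<in> G"
    then show "uo_conv G UNIV nat_order x l" if "limitin ?\<tau> x l sequentially"
      using lim_uo[OF S _ _ that] by simp
  qed (simp add: uo_lim)
  have "\<forall>\<sigma>. uo_Lebesgue_topology G \<sigma> \<and> Hausdorff_space \<sigma> \<longrightarrow> \<sigma> = ?\<tau>"
    using unique by (intro allI impI, elim conjE)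
  from uoL Haus this equiv sequential show ?thesis
    by (intro exI[of _ ?\<tau>] conjI)
qed

end
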